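(* Let $m\ge 1$ and $q\ge 0$ be fixed integers and $N=2q+1$. Assume that the sampling nodes $t_1,\dots,t_m$ are selected according to model (a) or model (b) described in the context, let $A\in\mathbb{C}^{m\times N}$ be the associated random matrix, let $r=\operatorname{rank}(A)$ (a random variable), and let $\sigma_1(A)\ge\dots\ge\sigma_r(A)>0$ be the nonzero singular values of $A$. Let $y=Ax+e$ and $\hat{x}=A^\dagger y$. Then $$\mathbb{E}\big[\|\hat{x}-x\|^2\big]=\frac{\epsilon^2}{m}\,\mathbb{E}\left[\sum_{i=1}^{r}\frac{1}{\sigma_i^2(A)}\right]+\mathbb{E}[N-r]$$ (as an identity in $[0,+\infty]$).
   Context: Sampling matrix: $\Gamma=\{-q,\dots,q\}$, $N=2q+1$, and $A\in\mathbb{C}^{m\times N}$ has entries $A_{l,k}=e^{2\pi \mathrm{i}kt_l}$ for $l=1,\dots,m$ and $k\in\Gamma$. Model (a): $t_1,\dots,t_m$ are i.i.d. random variables uniformly distributed over $[0,1]$. Model (b) (jittered sampling): $t_l=\frac{l-1}{m}+\delta_l$, $l=1,\dots,m$, where $\delta_1,\dots,\delta_m$ are i.i.d. uniformly distributed on $(0,T)$ for some $T>0$. Observation model: $y=Ax+e$, where $x\in\mathbb{C}^N$ is a random vector with $\mathbb{E}[xx^*]=I_N$, and $e\in\mathbb{C}^m$ is noise with $\operatorname{Re}(e),\operatorname{Im}(e)\sim\mathcal{N}(0,\frac{\epsilon^2}{2m}I_m)$ independent of each other (so $\mathbb{E}[ee^*]=\frac{\epsilon^2}{m}I_m$), with $\epsilon>0$.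 The vector $x$, the noise $e$ and the nodes $(t_l)$ are independent. $A^\dagger$ denotes the Moore–Penrose inverse and $\|\cdot\|$ the Euclidean norm. The expectation is over $x$, $e$ and the nodes. *)

theory Defs
  imports
    "HOL-Probability.Probability"
    "HOL-Computational_Algebra.Computational_Algebra"
    "Jordan_Normal_Form.Char_Poly"
    "Jordan_Normal_Form.Schur_Decomposition"
    "Jordan_Normal_Form.DL_Rank"
begin

(* Rows, nodes and columns are counted from 0: row l carries node number l + 1 and
   column j carries the frequency j - q in {-q..q}. *)
definition sampling_matrix :: "nat \<Rightarrow> nat \<Rightarrow> (nat \<Rightarrow> real) \<Rightarrow> complex mat" where
  "sampling_matrix m q t =
     mat m (2 * q + 1) (\<lambda>(l, j). exp (2 * of_real pi * \<i> * of_int (int j - int q) * of_real (t l)))"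

definition euclidean_norm_vec :: "complex vec \<Rightarrow> real" where
  "euclidean_norm_vec v = sqrt (\<Sum>i<dim_vec v. (cmod (v $ i))\<^sup>2)"

definition is_moore_penrose_inverse :: "complex mat \<Rightarrow> complex mat \<Rightarrow> bool" where
  "is_moore_penrose_inverse A X \<longleftrightarrow>
     X \<in> carrier_mat (dim_col A) (dim_row A) \<and>
     A * X * A = A \<and> X * A * X = X \<and>
     mat_adjoint (A * X) = A * X \<and> mat_adjoint (X * A) = X * A"

definition moore_penrose_inverse :: "complex mat \<Rightarrow> complex mat" where
  "moore_penrose_inverse A = (THE X. is_moore_penrose_inverse A X)"

definition matrix_rank :: "complex mat \<Rightarrow> nat" where
  "matrix_rank A = vec_space.rank (dim_row A) A"

(* Square roots of the eigenvalues (with algebraic multiplicity) of the positive semidefinite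
   matrix A^* A, in decreasing order. The list has length dim_col A, so for a wide matrix it
   is padded with zeros beyond min (dim_row A) (dim_col A). *)
definition singular_values :: "complex mat \<Rightarrow> real list" where
  "singular_values A =
     rev (sorted_list_of_multiset
       (image_mset (\<lambda>z. sqrt (Re z)) (proots (char_poly (mat_adjoint A * A)))))"

(* sigma_i with i counted from 1; meaningful for 1 <= i <= dim_col A *)
definition singular_value :: "complex mat \<Rightarrow> nat \<Rightarrow> real" where
  "singular_value A i = singular_values A ! (i - 1)"

definition iid_uniform :: "'w measure \<Rightarrow> nat \<Rightarrow> real set \<Rightarrow> (nat \<Rightarrow> 'w \<Rightarrow> real) \<Rightarrow> bool" where
  "iid_uniform M m S u \<longleftrightarrow>
     prob_space.indep_vars M (\<lambda>_. borel) u {..<m} \<and>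
     (\<forall>l<m. distr M lborel (u l) = uniform_measure lborel S)"

definition uniform_nodes :: "'w measure \<Rightarrow> nat \<Rightarrow> (nat \<Rightarrow> 'w \<Rightarrow> real) \<Rightarrow> bool" where
  "uniform_nodes M m t \<longleftrightarrow> iid_uniform M m {0..1} t"

definition jittered_nodes :: "'w measure \<Rightarrow> nat \<Rightarrow> real \<Rightarrow> (nat \<Rightarrow> 'w \<Rightarrow> real) \<Rightarrow> bool" where
  "jittered_nodes M m T t \<longleftrightarrow>
     (\<exists>\<delta>. iid_uniform M m {0<..<T} \<delta> \<and>
          (\<forall>l<m. \<forall>\<omega>\<in>space M. t l \<omega> = real l / real m + \<delta> l \<omega>))"

(* The law N(0, s^2 I_n) on R^n, s being the standard deviation. *)
definition isotropic_gaussian :: "nat \<Rightarrow> real \<Rightarrow> (nat \<Rightarrow> real) measure" where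
  "isotropic_gaussian n s = (\<Pi>\<^sub>M i\<in>{..<n}. density lborel (\<lambda>z. ennreal (normal_density 0 s z)))"

definition complex_gaussian_noise :: "'w measure \<Rightarrow> nat \<Rightarrow> real \<Rightarrow> (nat \<Rightarrow> 'w \<Rightarrow> complex) \<Rightarrow> bool" where
  "complex_gaussian_noise M m \<epsilon> e \<longleftrightarrow>
     (let R = (\<lambda>\<omega>. \<lambda>l\<in>{..<m}. Re (e l \<omega>));
          I = (\<lambda>\<omega>. \<lambda>l\<in>{..<m}. Im (e l \<omega>));
          P = (\<Pi>\<^sub>M l\<in>{..<m}. (borel :: real measure))
      in distr M P R = isotropic_gaussian m (\<epsilon> / sqrt (2 * real m)) \<and>
         distr M P I = isotropic_gaussian m (\<epsilon> / sqrt (2 * real m)) \<and>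
         prob_space.indep_var M P R P I)"

(* E[x x^*] = I_n, entrywise *)
definition isotropic_random_vector :: "'w measure \<Rightarrow> nat \<Rightarrow> (nat \<Rightarrow> 'w \<Rightarrow> complex) \<Rightarrow> bool" where
  "isotropic_random_vector M n x \<longleftrightarrow>
     (\<forall>j<n. x j \<in> borel_measurable M) \<and>
     (\<forall>j<n. \<forall>k<n. has_bochner_integral M (\<lambda>\<omega>. x j \<omega> * cnj (x k \<omega>)) (if j = k then 1 else 0))"

definition preimage_sets :: "'w measure \<Rightarrow> 'b measure \<Rightarrow> ('w \<Rightarrow> 'b) \<Rightarrow> 'w set set" where
  "preimage_sets M N X = {X -` B \<inter> space M | B. B \<in> sets N}"

(* Mutual independence of three random elements; the library's indep_vars requires all
   of them to have the same type of values. *)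
definition indep_var3 ::
  "'w measure \<Rightarrow> 'a measure \<Rightarrow> ('w \<Rightarrow> 'a) \<Rightarrow> 'b measure \<Rightarrow> ('w \<Rightarrow> 'b) \<Rightarrow>
    'c measure \<Rightarrow> ('w \<Rightarrow> 'c) \<Rightarrow> bool" where
  "indep_var3 M Ma X Mb Y Mc Z \<longleftrightarrow>
     X \<in> measurable M Ma \<and> Y \<in> measurable M Mb \<and> Z \<in> measurable M Mc \<and>
     prob_space.indep_sets M
       (\<lambda>i. [preimage_sets M Ma X, preimage_sets M Mb Y, preimage_sets M Mc Z] ! i) {0, 1, 2}"

end

theory Submission
  imports Defs "Jordan_Normal_Form.Spectral_Radius"
begin

text \<open>
  Diagonalise the Gram matrix as \<open>A\<^sup>* A = U D U\<^sup>*\<close> with \<open>U\<close> unitary and put \<open>B = A U\<close>, so that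
  \<open>B\<^sup>* B = D\<close>. Then \<open>A\<^sup>\<dagger> = U D\<^sup>+ B\<^sup>*\<close>, whence \<open>\<parallel>A\<^sup>\<dagger>\<parallel>\<^sup>2 = \<Sum> 1 / \<sigma>\<^sub>i\<^sup>2\<close> and
  \<open>\<parallel>A\<^sup>\<dagger> A - I\<parallel>\<^sup>2 = N - r\<close> in the Frobenius norm. The error is \<open>(A\<^sup>\<dagger> A - I) x + A\<^sup>\<dagger> e\<close>; since the
  nodes are independent of \<open>(x, e)\<close>, whose entries are uncorrelated, integrating over \<open>(x, e)\<close>
  first leaves \<open>\<epsilon>\<^sup>2/m \<parallel>A\<^sup>\<dagger>\<parallel>\<^sup>2 + \<parallel>A\<^sup>\<dagger> A - I\<parallel>\<^sup>2\<close>. Fubini's theorem needs \<open>A\<^sup>\<dagger>\<close> to be a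
  measurable function of the nodes: it is the pointwise limit of the Landweber iteration
  \<open>X \<mapsto> X + s (A\<^sup>* - A\<^sup>* A X)\<close>, whose iterates are polynomial in the entries of \<open>A\<close> and their
  conjugates.
\<close>

section \<open>Unitary diagonalisation of Hermitian matrices\<close>

text \<open>The rank of the sampling matrix can vary with the nodes, and the pseudoinverse is
  discontinuous where the rank drops, so its measurability does not follow from continuity. Nor is
  it clear that \<open>U\<close> and \<open>d\<close> can be chosen measurably. The iteration avoids
  both problems: eigendata enter only in the proof of convergence at a fixed node configuration. Its
  step size has to be common to all configurations. This is possible because the entries of every
  sampling matrix have modulus 1, so that its squared Frobenius norm is the constant
  \<open>m * (2 * q + 1)\<close>, which dominates every eigenvalue of the Gram matrix. The
  convention \<open>1 / 0 = 0\<close> turns entrywise reciprocals of \<open>D\<close> into its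
  pseudoinverse and lets sums over the nonzero eigenvalues run over all indices. The vector
  \<open>x\<close> may have a nonzero mean; it is uncorrelated with \<open>e\<close> because the
  noise is centred and independent of it. Since the expected sum of the
  \<open>1 / \<sigma>\<^sub>i\<^sup>2\<close> is allowed to be infinite, the error is split with
  nonnegative integrals throughout.\<close>

lemma mat_adjoint_carrier_iff [simp]:
  "mat_adjoint A \<in> carrier_mat n m \<longleftrightarrow> A \<in> carrier_mat m n"
  unfolding mat_adjoint_def carrier_mat_def by auto

lemmas mat_adjoint_carrier = mat_adjoint_carrier_iff [THEN iffD2]

lemma dim_mat_adjoint [simp]:
  "dim_row (mat_adjoint A) = dim_col A" "dim_col (mat_adjoint A) = dim_row A"
  unfolding mat_adjoint_def by auto

lemma index_mat_adjoint [simp]: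
  assumes "i < dim_col A" "j < dim_row A"
  shows "mat_adjoint (A :: complex mat) $$ (i, j) = cnj (A $$ (j, i))"
  using assms unfolding mat_adjoint_def by (simp add: mat_of_rows_index)

lemma mat_adjoint_mult:
  assumes "A \<in> carrier_mat n k" "B \<in> carrier_mat k p"
  shows "mat_adjoint (A * B :: complex mat) = mat_adjoint B * mat_adjoint A"
  using assms by (intro eq_matI) (auto simp: scalar_prod_def mult.commute intro!: sum.cong)

lemma mat_adjoint_adjoint [simp]: "mat_adjoint (mat_adjoint A :: complex mat) = A"
  by (intro eq_matI) auto

lemma mat_adjoint_mat_diag: "mat_adjoint (mat_diag n d) = mat_diag n (\<lambda>i. cnj (d i))"
  by (intro eq_matI) (auto simp: mat_diag_def)

text \<open>Used in the induction on the dimension: \<open>case_nat e d\<close> puts a new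
  eigenvalue in front of those already found.\<close>

lemma mat_diag_eq_four_block:
  "mat_diag (Suc n) (case_nat e d) =
     four_block_mat (mat 1 1 (\<lambda>_. e)) (0\<^sub>m 1 n) (0\<^sub>m n 1) (mat_diag n d)"
proof (rule eq_matI)
  fix i j
  assume "i < dim_row (four_block_mat (mat 1 1 (\<lambda>_. e)) (0\<^sub>m 1 n) (0\<^sub>m n 1) (mat_diag n d))"
    "j < dim_col (four_block_mat (mat 1 1 (\<lambda>_. e)) (0\<^sub>m 1 n) (0\<^sub>m n 1) (mat_diag n d))"
  then show "mat_diag (Suc n) (case_nat e d) $$ (i, j) =
     four_block_mat (mat 1 1 (\<lambda>_. e)) (0\<^sub>m 1 n) (0\<^sub>m n 1) (mat_diag n d) $$ (i, j)"
    by (cases i; cases j) (auto simp: mat_diag_def)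
qed (auto simp: mat_diag_def)

lemma mat_adjoint_four_block:
  assumes "A \<in> carrier_mat n1 m1" "B \<in> carrier_mat n1 m2"
    "C \<in> carrier_mat n2 m1" "D \<in> carrier_mat n2 m2"
  shows "mat_adjoint (four_block_mat A B C D :: complex mat) =
    four_block_mat (mat_adjoint A) (mat_adjoint C) (mat_adjoint B) (mat_adjoint D)"
  using assms by (intro eq_matI) auto

lemma adjoint_mult_self_eq_gram:
  assumes "W \<in> carrier_mat k n" "i < n" "j < n"
  shows "(mat_adjoint W * W) $$ (i, j) = (\<Sum>l<k. cnj (W $$ (l, i)) * W $$ (l, j))"
  using assms by (auto simp: scalar_prod_def atLeast0LessThan intro!: sum.cong)

lemma unitary_commute:
  assumes "U \<in> carrier_mat n n" "mat_adjoint U * U = (1\<^sub>m n :: complex mat)"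
  shows "U * mat_adjoint U = 1\<^sub>m n"
  using mat_mult_left_right_inverse[OF mat_adjoint_carrier[OF assms(1)] assms(1,2)] .

text \<open>Complete \<open>v\<close> to a basis, orthogonalise and normalise. Gram-Schmidt keeps
  the first vector, so only the normalisation changes it; this is the scalar
  \<open>c\<close>.\<close>

lemma unitary_with_first_column:
  fixes v :: "complex vec"
  assumes v: "v \<in> carrier_vec n" and v0: "v \<noteq> 0\<^sub>v n"
  obtains W c where "W \<in> carrier_mat n n" "mat_adjoint W * W = 1\<^sub>m n" "col W 0 = c \<cdot>\<^sub>v v"
proof -
  interpret cof_vec_space n "TYPE(complex)" .
  define ws where "ws = gram_schmidt n (basis_completion v)"
  note bc = basis_completion[OF v v0]
  from v v0 have n: "0 < n"
    by (metis gr_zeroI vec_of_dim_0 carrier_vecD)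
  have b: "basis_completion v = v # tl (basis_completion v)"
    using bc(6,7) n by (cases "basis_completion v") auto
  have hd: "hd ws = v" unfolding ws_def by (subst b) (rule gram_schmidt_hd[OF v])
  have ws: "set ws \<subseteq> carrier_vec n" "corthogonal ws" "length ws = n"
    using gram_schmidt_result[OF bc(2) bc(4) bc(5) ws_def] bc(6) by auto
  \<comment> \<open>The vectors in \<open>ws\<close> are orthogonal but not of unit length;
    \<open>s w\<close> is the reciprocal of the norm of \<open>w\<close>.\<close>
  define s where "s w = complex_of_real (1 / sqrt (Re (w \<bullet>c w)))" for w :: "complex vec"
  have cs: "cnj (s w) = s w" for w by (simp add: s_def)
  define W where "W = mat n n (\<lambda>(i, j). s (ws ! j) * (ws ! j) $ i)"
  have dimw: "dim_vec (ws ! j) = n" if "j < n" for j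
    by (metis that carrier_vecD nth_mem subsetD ws(1,3))
  have pos: "Re (ws ! j \<bullet>c ws ! j) > 0" "Im (ws ! j \<bullet>c ws ! j) = 0" if "j < n" for j
  proof -
    have sq: "ws ! j \<bullet>c ws ! j = of_real (\<Sum>i<n. (cmod ((ws ! j) $ i))\<^sup>2)"
      using dimw[OF that]
      by (auto simp: scalar_prod_def atLeast0LessThan complex_norm_square[symmetric] intro!: sum.cong)
    have "ws ! j \<bullet>c ws ! j \<noteq> 0" using corthogonalD[OF ws(2)] ws(3) that by blast
    then show "Re (ws ! j \<bullet>c ws ! j) > 0" "Im (ws ! j \<bullet>c ws ! j) = 0"
      unfolding sq by (auto simp: sum_nonneg less_le simp del: of_real_sum of_real_power)
  qed
  have "mat_adjoint W * W = 1\<^sub>m n"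
  proof (rule eq_matI)
    fix i j assume "i < dim_row (1\<^sub>m n :: complex mat)" "j < dim_col (1\<^sub>m n :: complex mat)"
    then have ij: "i < n" "j < n" by auto
    have "(mat_adjoint W * W) $$ (i, j) =
        (\<Sum>l<n. cnj (s (ws ! i) * (ws ! i) $ l) * (s (ws ! j) * (ws ! j) $ l))"
      using ij by (subst adjoint_mult_self_eq_gram[of _ n n]) (auto simp: W_def intro!: sum.cong)
    also have "\<dots> = s (ws ! i) * s (ws ! j) * (ws ! j \<bullet>c ws ! i)"
      using dimw ij
      by (auto simp: scalar_prod_def atLeast0LessThan sum_distrib_left cs mult_ac intro!: sum.cong)
    also have "\<dots> = 1\<^sub>m n $$ (i, j)"
    proof (cases "i = j")
      case True
      have "ws ! j \<bullet>c ws ! j = of_real (Re (ws ! j \<bullet>c ws ! j))"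
        using pos[OF ij(2)] by (simp add: complex_eq_iff)
      moreover have "s (ws ! j) * s (ws ! j) * of_real (Re (ws ! j \<bullet>c ws ! j)) = 1"
        using pos(1)[OF ij(2)] unfolding s_def of_real_mult[symmetric] by simp
      ultimately show ?thesis using True ij by simp
    next
      case False
      then show ?thesis using corthogonalD[OF ws(2), of j i] ij ws(3) by auto
    qed
    finally show "(mat_adjoint W * W) $$ (i, j) = 1\<^sub>m n $$ (i, j)" .
  qed (auto simp: W_def)
  moreover have "col W 0 = s v \<cdot>\<^sub>v v"
  proof -
    have "ws ! 0 = v" using hd ws(3) n by (metis hd_conv_nth length_greater_0_conv)
    then show ?thesis using n v by (intro eq_vecI) (auto simp: W_def)
  qed
  ultimately show ?thesis using that[of W "s v"] by (auto simp: W_def)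
qed

text \<open>Deflation: in a unitary basis that starts with an eigenvector, the first column of
  \<open>H\<close> is a multiple of the first unit vector. Hermitian symmetry clears the first row
  too, and the remaining block is Hermitian of size \<open>n\<close>. The diagonal is left complex
  here; for Gram matrices its reality is shown later.\<close>

theorem hermitian_diagonalization:
  fixes H :: "complex mat"
  assumes "H \<in> carrier_mat n n" "mat_adjoint H = H"
  shows "\<exists>U d. U \<in> carrier_mat n n \<and> mat_adjoint U * U = 1\<^sub>m n \<and>
    H = U * mat_diag n d * mat_adjoint U"
  using assms
proof (induction n arbitrary: H)
  case 0
  then show ?case by (intro exI[of _ "1\<^sub>m 0"] exI[of _ undefined]) auto
next
  case (Suc n)
  let ?N = "Suc n"
  note H = Suc.prems(1)
  from spectrum_non_empty[OF H] obtain e where "eigenvalue H e"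
    unfolding spectrum_def by auto
  then obtain v where v: "v \<in> carrier_vec ?N" "v \<noteq> 0\<^sub>v ?N" and ev: "H *\<^sub>v v = e \<cdot>\<^sub>v v"
    using H unfolding eigenvalue_def eigenvector_def by auto
  obtain W c where W: "W \<in> carrier_mat ?N ?N" and WW: "mat_adjoint W * W = 1\<^sub>m ?N"
    and c: "col W 0 = c \<cdot>\<^sub>v v"
    using unitary_with_first_column[OF v] by metis
  note aW = mat_adjoint_carrier[OF W]
  note WW' = unitary_commute[OF W WW]
  define K where "K = mat_adjoint W * H * W"
  have K: "K \<in> carrier_mat ?N ?N" using W aW H by (auto simp: K_def)
  have Kherm: "mat_adjoint K = K"
    unfolding K_def using W aW H Suc.prems(2)
    by (simp add: mat_adjoint_mult[of _ ?N ?N _ ?N] assoc_mult_mat[of _ ?N ?N _ ?N _ ?N])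
  have col0: "K $$ (i, 0) = (if i = 0 then e else 0)" if "i < ?N" for i
  proof -
    have "col K 0 = mat_adjoint W *\<^sub>v (H *\<^sub>v col W 0)"
      unfolding K_def assoc_mult_mat[OF aW H W] col_mult2[OF aW mult_carrier_mat[OF H W] zero_less_Suc]
        col_mult2[OF H W zero_less_Suc] ..
    also have "H *\<^sub>v col W 0 = e \<cdot>\<^sub>v col W 0"
      unfolding c using H v ev by (simp add: mult_mat_vec smult_smult_assoc mult.commute)
    also have "mat_adjoint W *\<^sub>v (e \<cdot>\<^sub>v col W 0) = e \<cdot>\<^sub>v (mat_adjoint W *\<^sub>v col W 0)"
      by (intro mult_mat_vec[OF aW] carrier_vecI) (use W in simp)
    also have "mat_adjoint W *\<^sub>v col W 0 = col (mat_adjoint W * W) 0"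
      using col_mult2[OF aW W zero_less_Suc] ..
    finally have "col K 0 = e \<cdot>\<^sub>v col (1\<^sub>m ?N) 0" unfolding WW .
    then have "col K 0 $ i = (e \<cdot>\<^sub>v col (1\<^sub>m ?N) 0) $ i" by simp
    then show ?thesis using that K by auto
  qed
  \<comment> \<open>Only here is symmetry used to split off the eigenvalue: row 0 is the conjugate
    of column 0.\<close>
  have row0: "K $$ (0, j) = (if j = 0 then e else 0)" if "j < ?N" for j
  proof (cases "j = 0")
    case False
    have "K $$ (0, j) = mat_adjoint K $$ (0, j)" using Kherm by simp
    also have "\<dots> = cnj (K $$ (j, 0))" using that K by (intro index_mat_adjoint) auto
    finally show ?thesis using col0[OF that] False by simp
  qed (use col0[OF that] in auto)
  define L where "L = mat n n (\<lambda>(i, j). K $$ (Suc i, Suc j))"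
  have L: "L \<in> carrier_mat n n" by (simp add: L_def)
  have "mat_adjoint L = L"
  proof (rule eq_matI)
    fix i j assume "i < dim_row L" "j < dim_col L"
    then have ij: "i < n" "j < n" using L by auto
    have "cnj (K $$ (Suc j, Suc i)) = mat_adjoint K $$ (Suc i, Suc j)" using K ij by simp
    then show "mat_adjoint L $$ (i, j) = L $$ (i, j)" using ij Kherm by (simp add: L_def)
  qed (use L in auto)
  from Suc.IH[OF L this] obtain U d where U: "U \<in> carrier_mat n n"
    and UU: "mat_adjoint U * U = 1\<^sub>m n" and LU: "L = U * mat_diag n d * mat_adjoint U" by blast
  note aU = mat_adjoint_carrier[OF U]
  \<comment> \<open>The unitary from the induction hypothesis, bordered by a 1, so that it leaves
    the eigenvector already found alone.\<close>
  define V where "V = four_block_mat (1\<^sub>m 1) (0\<^sub>m 1 n) (0\<^sub>m n 1) U"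
  define D where "D = mat_diag ?N (case_nat e d)"
  have V: "V \<in> carrier_mat ?N ?N" using U by (auto simp: V_def)
  have D: "D \<in> carrier_mat ?N ?N" by (simp add: D_def)
  have aV: "mat_adjoint V = four_block_mat (1\<^sub>m 1) (0\<^sub>m 1 n) (0\<^sub>m n 1) (mat_adjoint U)"
    unfolding V_def using U by (subst mat_adjoint_four_block[of _ 1 1 _ n _ n])
      (auto intro!: cong_four_block_mat eq_matI)
  have VV: "mat_adjoint V * V = 1\<^sub>m ?N"
    unfolding aV unfolding V_def using U aU UU
    by (subst mult_four_block_mat[of _ 1 1 _ n _ n _ _ 1 _ n]) auto
  have DV: "V * D * mat_adjoint V = four_block_mat (mat 1 1 (\<lambda>_. e)) (0\<^sub>m 1 n) (0\<^sub>m n 1) L"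
  proof -
    note UD = mult_carrier_mat[OF U mat_diag_dim[of n d]]
    have z: "0\<^sub>m (Suc 0) n * mat_diag n d = 0\<^sub>m (Suc 0) n" "0\<^sub>m (Suc 0) n * mat_adjoint U = 0\<^sub>m (Suc 0) n"
      "U * mat_diag n d * 0\<^sub>m n (Suc 0) = 0\<^sub>m n (Suc 0)"
      by (rule left_mult_zero_mat[OF mat_diag_dim] left_mult_zero_mat[OF aU] right_mult_zero_mat[OF UD])+
    show ?thesis
      unfolding aV unfolding V_def D_def mat_diag_eq_four_block LU using U aU z
        mult_carrier_mat[OF UD aU] UD
      by (subst mult_four_block_mat[of _ 1 1 _ n _ n _ _ 1 _ n], auto)
         (subst mult_four_block_mat[of _ 1 1 _ n _ n _ _ 1 _ n], auto)
  qed
  also have "\<dots> = K"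
  proof (rule eq_matI)
    fix i j assume "i < dim_row K" "j < dim_col K"
    then have "i < ?N" "j < ?N" using K by auto
    then show "four_block_mat (mat 1 1 (\<lambda>_. e)) (0\<^sub>m 1 n) (0\<^sub>m n 1) L $$ (i, j) = K $$ (i, j)"
      using row0[of j] col0[of i] by (cases i; cases j) (auto simp: L_def)
  qed (use K L in auto)
  finally have KV: "V * D * mat_adjoint V = K" .
  note aV' = mat_adjoint_carrier[OF V]
  have "H = W * (mat_adjoint W * H * W) * mat_adjoint W"
  proof -
    have "W * (mat_adjoint W * H * W) * mat_adjoint W =
        (W * mat_adjoint W) * H * (W * mat_adjoint W)"
      using W aW H by (simp add: assoc_mult_mat[of _ ?N ?N _ ?N _ ?N])
    then show ?thesis using WW' H by simp
  qed
  also have "\<dots> = W * (V * D * mat_adjoint V) * mat_adjoint W"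
    unfolding KV K_def ..
  also have "\<dots> = (W * V) * D * mat_adjoint (W * V)"
    using W aW V aV' D
    by (simp add: assoc_mult_mat[of _ ?N ?N _ ?N _ ?N] mat_adjoint_mult[of _ ?N ?N _ ?N])
  finally have "H = (W * V) * D * mat_adjoint (W * V)" .
  moreover have "mat_adjoint (W * V) * (W * V) = 1\<^sub>m ?N"
  proof -
    have "mat_adjoint (W * V) * (W * V) = mat_adjoint V * (mat_adjoint W * W) * V"
      using W aW V aV'
      by (simp add: assoc_mult_mat[of _ ?N ?N _ ?N _ ?N] mat_adjoint_mult[of _ ?N ?N _ ?N])
    then show ?thesis using WW VV aV' by simp
  qed
  moreover have "W * V \<in> carrier_mat ?N ?N" using W V by simp
  ultimately show ?case unfolding D_def by blast
qed

section \<open>The Moore-Penrose inverse and singular values\<close>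

context vec_space
begin

lemma mult_mat_vec_in_span_cols:
  assumes "A \<in> carrier_mat n k" "v \<in> carrier_vec k"
  shows "A *\<^sub>v v \<in> span (set (cols A))"
proof -
  have c: "set (cols A) \<subseteq> carrier_vec n" using cols_dim assms(1) by blast
  have "lincomb_list (\<lambda>i. v $ i) (cols A) = mat_of_cols n (cols A) *\<^sub>v vec (length (cols A)) (\<lambda>i. v $ i)"
    using c by (intro lincomb_list_as_mat_mult) auto
  also have "mat_of_cols n (cols A) = A" using assms(1) by auto
  also have "vec (length (cols A)) (\<lambda>i. v $ i) = v" using assms by auto
  finally have "A *\<^sub>v v = lincomb_list (\<lambda>i. v $ i) (cols A)" by (rule sym)
  then have "A *\<^sub>v v \<in> span_list (cols A)" unfolding span_list_def by blast
  then show ?thesis using span_list_as_span[OF c] by simp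
qed

text \<open>Each column of \<open>A * Z\<close> lies in the column space of \<open>A\<close>.
  Applied in both directions, this shows that two matrices which are right multiples of each other
  have equal rank.\<close>

lemma rank_mult_le:
  assumes A: "A \<in> carrier_mat n k" and Z: "Z \<in> carrier_mat k p"
  shows "rank (A * Z) \<le> rank A"
proof -
  have sub: "set (cols (A * Z)) \<subseteq> span (set (cols A))"
  proof
    fix v assume "v \<in> set (cols (A * Z))"
    then obtain j where j: "j < dim_col (A * Z)" "v = col (A * Z) j"
      by (metis cols_length cols_nth in_set_conv_nth)
    then have "v = A *\<^sub>v col Z j" using col_mult2[OF A Z, of j] Z by simp
    then show "v \<in> span (set (cols A))"
      using mult_mat_vec_in_span_cols[OF A, of "col Z j"] Z by (simp add: carrier_vecI)
  qed
  have cA: "set (cols A) \<subseteq> carrier_vec n" using cols_dim A by blast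
  have vs: "vectorspace class_ring (span_vs (set (cols A)))"
    using span_is_subspace[THEN subspace_is_vs, OF cA] .
  have "submodule class_ring (span (set (cols A))) V" using span_is_submodule[OF cA] .
  \<comment> \<open>Monotonicity of the dimension is applied inside the span of the columns of
    \<open>A\<close>, which serves as the ambient space.\<close>
  then have "subspace class_ring (span (set (cols (A * Z)))) (span_vs (set (cols A)))"
    using vectorspace.span_is_subspace[OF vs, of "set (cols (A * Z))",
      unfolded span_li_not_depend(1)[OF sub \<open>submodule class_ring (span (set (cols A))) V\<close>]] sub by auto
  moreover have "vectorspace.fin_dim class_ring (span_vs (set (cols A)))"
    "vectorspace.fin_dim class_ring (span_vs (set (cols A))\<lparr>carrier := span (set (cols (A * Z)))\<rparr>)"
    using fin_dim_span_cols[OF A] fin_dim_span_cols[OF mult_carrier_mat[OF A Z]] by auto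
  ultimately show ?thesis
    unfolding rank_def using vectorspace.subspace_dim[OF vs] by simp
qed

end

text \<open>If \<open>C\<close> kills \<open>v\<close>, so does its Gram matrix, and then
  \<open>f i * v $ i = 0\<close> for each \<open>i\<close>.\<close>

lemma rank_orthogonal_cols:
  fixes C :: "complex mat"
  assumes C: "C \<in> carrier_mat m k" and CC: "mat_adjoint C * C = mat_diag k f"
    and f: "\<And>i. i < k \<Longrightarrow> f i \<noteq> 0"
  shows "vec_space.rank m C = k"
proof -
  interpret vec_space "TYPE(complex)" m .
  note aC = mat_adjoint_carrier[OF C]
  \<comment> \<open>Linear dependence refers to the set of columns, so repetitions must be excluded:
    equal columns \<open>i\<close> and \<open>j\<close> would make an off-diagonal entry equal to
    \<open>f i\<close>.\<close>
  have dist: "distinct (cols C)"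
    unfolding distinct_conv_nth
  proof (intro allI impI notI)
    fix i j assume ij: "i < length (cols C)" "j < length (cols C)" "i \<noteq> j" "cols C ! i = cols C ! j"
    then have "(mat_adjoint C * C) $$ (i, j) = (mat_adjoint C * C) $$ (i, i)" using C by simp
    then show False unfolding CC using ij f C by (auto simp: mat_diag_def)
  qed
  have "\<not> lin_dep (set (cols C))"
  proof
    assume "lin_dep (set (cols C))"
    from lin_depE[OF C this dist] obtain v where v: "v \<in> carrier_vec k" "v \<noteq> 0\<^sub>v k" "C *\<^sub>v v = 0\<^sub>v m"
      by auto
    have "mat_diag k f *\<^sub>v v = mat_adjoint C *\<^sub>v (C *\<^sub>v v)"
      unfolding CC[symmetric] using assoc_mult_mat_vec[OF aC C v(1)] .
    also have "\<dots> = 0\<^sub>v k" unfolding v(3) using aC by auto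
    finally have z: "mat_diag k f *\<^sub>v v = 0\<^sub>v k" .
    have "v $ i = 0" if "i < k" for i
    proof -
      have "(mat_diag k f *\<^sub>v v) $ i = f i * v $ i"
        using that v(1)
        by (auto simp: mat_diag_def scalar_prod_def if_distrib[where f="\<lambda>x. x * _"] cong: if_cong)
      then show ?thesis using z f[OF that] that by simp
    qed
    then have "v = 0\<^sub>v k" using v(1) by (intro eq_vecI) auto
    then show False using v(2) by simp
  qed
  then show ?thesis using lin_indpt_full_rank[OF C dist] by simp
qed

text \<open>Penrose's argument: \<open>A * X = (A * Y) * (A * X)\<close> is a product of Hermitian
  matrices, and taking adjoints swaps the factors, which gives \<open>A * X = A * Y\<close>.
  Likewise \<open>X * A = Y * A\<close>, and then
  \<open>X = X * A * X = Y * A * Y = Y\<close>.\<close>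

lemma moore_penrose_inverse_unique:
  fixes A :: "complex mat"
  assumes A: "A \<in> carrier_mat m n"
    and X: "is_moore_penrose_inverse A X" and Y: "is_moore_penrose_inverse A Y"
  shows "X = Y"
proof -
  have cX: "X \<in> carrier_mat n m" and cY: "Y \<in> carrier_mat n m"
    using X Y A by (auto simp: is_moore_penrose_inverse_def)
  have AX: "A * X \<in> carrier_mat m m" and AY: "A * Y \<in> carrier_mat m m"
    and XA: "X * A \<in> carrier_mat n n" and YA: "Y * A \<in> carrier_mat n n"
    using A cX cY by auto
  have x: "A * X * A = A" "X * A * X = X" "mat_adjoint (A * X) = A * X" "mat_adjoint (X * A) = X * A"
    and y: "A * Y * A = A" "Y * A * Y = Y" "mat_adjoint (A * Y) = A * Y" "mat_adjoint (Y * A) = Y * A"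
    using X Y by (auto simp: is_moore_penrose_inverse_def)
  have "A * X = A * Y * A * X" using y by simp
  also have "\<dots> = (A * Y) * (A * X)" using assoc_mult_mat[OF AY A cX] .
  finally have 1: "A * X = (A * Y) * (A * X)" .
  have "A * X = mat_adjoint ((A * Y) * (A * X))" using 1 x(3) by simp
  also have "\<dots> = (A * X) * (A * Y)" using mat_adjoint_mult[OF AY AX] x(3) y(3) by simp
  also have "\<dots> = A * X * A * Y" using assoc_mult_mat[OF AX A cY] by simp
  finally have eq1: "A * X = A * Y" using x(1) by simp
  have "X * A = X * (A * Y * A)" using y by simp
  also have "\<dots> = (X * A) * (Y * A)"
    using assoc_mult_mat[OF cX A YA] assoc_mult_mat[OF A cY A] by simp
  finally have 2: "X * A = (X * A) * (Y * A)" .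
  have "X * A = mat_adjoint ((X * A) * (Y * A))" using 2 x(4) by simp
  also have "\<dots> = (Y * A) * (X * A)" using mat_adjoint_mult[OF XA YA] x(4) y(4) by simp
  also have "\<dots> = Y * (A * X * A)"
    using assoc_mult_mat[OF cY A XA] assoc_mult_mat[OF A cX A] by simp
  finally have eq2: "X * A = Y * A" using x(1) by simp
  have "X = (Y * A) * X" using x(2) eq2 by simp
  also have "\<dots> = Y * (A * Y)" using assoc_mult_mat[OF cY A cX] eq1 by simp
  also have "\<dots> = Y" using assoc_mult_mat[OF cY A cY] y(2) by simp
  finally show ?thesis .
qed

lemma moore_penrose_inverse_eqI:
  assumes "is_moore_penrose_inverse A X"
  shows "moore_penrose_inverse A = X"
  unfolding moore_penrose_inverse_def
  using assms moore_penrose_inverse_unique[of A "dim_row A" "dim_col A"] by (intro the_equality) auto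

section \<open>Trace and Frobenius norm\<close>

definition mat_tr :: "complex mat \<Rightarrow> complex" where
  "mat_tr A = (\<Sum>i<dim_row A. A $$ (i, i))"

definition frobenius_sq :: "complex mat \<Rightarrow> real" where
  "frobenius_sq A = (\<Sum>i<dim_row A. \<Sum>j<dim_col A. (cmod (A $$ (i, j)))\<^sup>2)"

lemma mat_tr_commute:
  assumes "A \<in> carrier_mat n k" "B \<in> carrier_mat k n"
  shows "mat_tr (A * B) = mat_tr (B * A)"
proof -
  have "mat_tr (A * B) = (\<Sum>i<n. \<Sum>j<k. A $$ (i, j) * B $$ (j, i))"
    using assms by (auto simp: mat_tr_def scalar_prod_def atLeast0LessThan intro!: sum.cong)
  also have "\<dots> = (\<Sum>j<k. \<Sum>i<n. B $$ (j, i) * A $$ (i, j))"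
    by (subst sum.swap) (simp add: mult.commute)
  also have "\<dots> = mat_tr (B * A)"
    using assms by (auto simp: mat_tr_def scalar_prod_def atLeast0LessThan intro!: sum.cong)
  finally show ?thesis .
qed

lemma mat_tr_mat_diag: "mat_tr (mat_diag n f) = (\<Sum>i<n. f i)"
  by (simp add: mat_tr_def mat_diag_def)

text \<open>Makes the Frobenius norm accessible to \<open>mat_tr_commute\<close>, by which unitary
  factors cancel.\<close>

lemma frobenius_sq_eq_tr: "complex_of_real (frobenius_sq A) = mat_tr (A * mat_adjoint A)"
  by (auto simp: frobenius_sq_def mat_tr_def scalar_prod_def atLeast0LessThan
      complex_norm_square[symmetric] intro!: sum.cong)

text \<open>In such a list nothing but zeros can follow a zero, so the nonzero entries form an
  initial segment.\<close>

lemma decreasing_nonneg_nth_zero: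
  fixes xs :: "real list"
  assumes "sorted_wrt (\<ge>) xs" "\<And>x. x \<in> set xs \<Longrightarrow> 0 \<le> x"
    "length (filter (\<lambda>x. x \<noteq> 0) xs) \<le> i" "i < length xs"
  shows "xs ! i = 0"
  using assms
proof (induction xs arbitrary: i)
  case (Cons x xs)
  show ?case
  proof (cases "x = 0")
    case True
    then have "\<forall>y\<in>set (x # xs). y = 0" using Cons.prems(1,2) by force
    then show ?thesis using Cons.prems(4) nth_mem by blast
  next
    case False
    then obtain j where "i = Suc j" using Cons.prems(3) by (cases i) auto
    then show ?thesis using Cons False by auto
  qed
qed simp

text \<open>A locale, because every matrix of the random family gets its own \<open>U\<close> and
  \<open>d\<close>, interpreted at one sample point at a time. The eigenvalues are taken real from
  the start; their signs are derived.\<close>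

locale gram_diagonalization =
  fixes A U :: "complex mat" and m n :: nat and d :: "nat \<Rightarrow> real"
  assumes A: "A \<in> carrier_mat m n" and U: "U \<in> carrier_mat n n"
    and unitary: "mat_adjoint U * U = 1\<^sub>m n"
    and gram: "mat_adjoint A * A = U * mat_diag n (\<lambda>i. of_real (d i)) * mat_adjoint U"

lemma gram_diagonalization_exists:
  assumes A: "A \<in> carrier_mat m n"
  obtains U d where "gram_diagonalization A U m n d"
proof -
  let ?H = "mat_adjoint A * A"
  have H: "?H \<in> carrier_mat n n" using A by auto
  have "mat_adjoint ?H = ?H" using A by (simp add: mat_adjoint_mult[of _ n m _ n])
  from hermitian_diagonalization[OF H this] obtain U e where U: "U \<in> carrier_mat n n"
    and UU: "mat_adjoint U * U = 1\<^sub>m n" and HU: "?H = U * mat_diag n e * mat_adjoint U" by blast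
  note aU = mat_adjoint_carrier[OF U]
  have "mat_adjoint (A * U) * (A * U) = mat_adjoint U * ?H * U"
    using A U by (simp add: mat_adjoint_mult[of _ m n _ n] assoc_mult_mat[of _ n n _ n _ n]
        assoc_mult_mat[of _ n m _ n _ n] assoc_mult_mat[of _ n n _ m _ n])
  also have "\<dots> = (mat_adjoint U * U) * mat_diag n e * (mat_adjoint U * U)"
    unfolding HU using U aU by (simp add: assoc_mult_mat[of _ n n _ n _ n] mult_carrier_mat[of _ n n])
  finally have D: "mat_adjoint (A * U) * (A * U) = mat_diag n e"
    unfolding UU by (simp add: left_mult_one_mat[of _ n n] right_mult_one_mat[of _ n n])
  \<comment> \<open>A diagonal entry of a Gram matrix is the squared norm of a column, here column
    \<open>i\<close> of \<open>A * U\<close>.\<close>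
  have "e i = of_real (Re (e i))" if i: "i < n" for i
  proof -
    have "e i = (mat_adjoint (A * U) * (A * U)) $$ (i, i)"
      unfolding D using i by (simp add: mat_diag_def)
    also have "\<dots> = (\<Sum>l<m. cnj ((A * U) $$ (l, i)) * (A * U) $$ (l, i))"
      using A U i by (intro adjoint_mult_self_eq_gram) auto
    finally have "e i = \<dots>" .
    then have "Im (e i) = 0" by (simp add: mult.commute)
    then show ?thesis by (simp add: complex_eq_iff)
  qed
  then have "mat_diag n e = mat_diag n (\<lambda>i. of_real (Re (e i)))"
    by (intro eq_matI) (auto simp: mat_diag_def)
  then show ?thesis using that[of U "\<lambda>i. Re (e i)"] A U UU HU
    by (auto simp: gram_diagonalization_def)
qed

section \<open>Pseudoinverse, rank and singular values in an eigenbasis of the Gram matrix\<close>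

context gram_diagonalization
begin

lemma unitary': "U * mat_adjoint U = 1\<^sub>m n"
  by (rule unitary_commute[OF U unitary])

text \<open>The columns are pairwise orthogonal, with squared norms \<open>d i\<close>: left
  singular vectors scaled by their singular values. Leaving them unnormalised avoids dividing by
  zero singular values.\<close>

definition B where "B = A * U"

lemma B: "B \<in> carrier_mat m n"
  using A U by (simp add: B_def)

lemma A_eq: "A = B * mat_adjoint U"
  using A U unitary' by (simp add: B_def assoc_mult_mat[of _ m n _ n _ n])

lemma gram_B: "mat_adjoint B * B = mat_diag n (\<lambda>i. of_real (d i))"
proof -
  note aU = mat_adjoint_carrier[OF U]
  have "mat_adjoint B * B = mat_adjoint U * (mat_adjoint A * A) * U"
    unfolding B_def
    using A U by (simp add: mat_adjoint_mult[of _ m n _ n] assoc_mult_mat[of _ n n _ n _ n]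
        assoc_mult_mat[of _ n m _ n _ n] assoc_mult_mat[of _ n n _ m _ n])
  also have "\<dots> = (mat_adjoint U * U) * mat_diag n (\<lambda>i. of_real (d i)) * (mat_adjoint U * U)"
    unfolding gram using U aU
    by (simp add: assoc_mult_mat[of _ n n _ n _ n] mult_carrier_mat[of _ n n])
  finally show ?thesis
    unfolding unitary by (simp add: left_mult_one_mat[of _ n n] right_mult_one_mat[of _ n n])
qed

lemma d_eq: "d i = (\<Sum>l<m. (cmod (B $$ (l, i)))\<^sup>2)" if "i < n"
proof -
  have "complex_of_real (d i) = (mat_adjoint B * B) $$ (i, i)"
    unfolding gram_B using that by (simp add: mat_diag_def)
  also have "\<dots> = (\<Sum>l<m. cnj (B $$ (l, i)) * B $$ (l, i))"
    using B that by (intro adjoint_mult_self_eq_gram) auto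
  also have "\<dots> = complex_of_real (\<Sum>l<m. (cmod (B $$ (l, i)))\<^sup>2)"
    unfolding of_real_sum complex_norm_square by (simp add: mult.commute)
  finally show ?thesis unfolding of_real_eq_iff .
qed

lemma d_nonneg: "0 \<le> d i" if "i < n"
  unfolding d_eq[OF that] by (simp add: sum_nonneg)

text \<open>By \<open>d_eq\<close> this column has norm zero. Hence the value of a filter at an
  index with \<open>d i = 0\<close> never matters once it is multiplied by \<open>B\<close>.\<close>

lemma B_zero: "B $$ (l, i) = 0" if "i < n" "l < m" "d i = 0"
proof -
  have "\<forall>l\<in>{..<m}. (cmod (B $$ (l, i)))\<^sup>2 = 0"
    using that(3) unfolding d_eq[OF that(1)] by (subst (asm) sum_nonneg_eq_0_iff) auto
  then show ?thesis using that(2) by simp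
qed

text \<open>Both sides are the trace of the Gram matrix. It follows that every \<open>d i\<close> is
  at most the squared Frobenius norm, which controls the step size of the iteration.\<close>

lemma sum_d_eq: "(\<Sum>i<n. d i) = frobenius_sq A"
proof -
  have "complex_of_real (\<Sum>i<n. d i) = mat_tr (mat_diag n (\<lambda>i. of_real (d i)))"
    by (simp add: mat_tr_mat_diag)
  also have "\<dots> = mat_tr (B * mat_adjoint B)"
    unfolding gram_B[symmetric] using B by (intro mat_tr_commute) auto
  also have "B * mat_adjoint B = A * mat_adjoint A"
  proof -
    have "B * mat_adjoint B = A * (U * mat_adjoint U) * mat_adjoint A"
      using A U by (simp add: B_def mat_adjoint_mult[of _ m n _ n] assoc_mult_mat[of _ m n _ n _ m]
          assoc_mult_mat[of _ n n _ n _ m] assoc_mult_mat[of _ m n _ n _ n] mult_carrier_mat[of _ n n])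
    then show ?thesis unfolding unitary' using A by simp
  qed
  also have "mat_tr (A * mat_adjoint A) = of_real (frobenius_sq A)"
    by (rule frobenius_sq_eq_tr[symmetric])
  finally show ?thesis unfolding of_real_eq_iff .
qed

text \<open>Spectral filters: the adjoint of \<open>A\<close> is the filter 1, the pseudoinverse is
  \<open>dinv\<close>, and all Landweber iterates have this form. Multiplying by the Gram matrix
  from the left multiplies the filter by \<open>d\<close>, so matrix identities become scalar
  ones.\<close>

definition gdiag :: "(nat \<Rightarrow> complex) \<Rightarrow> complex mat" where
  "gdiag f = U * mat_diag n f * mat_adjoint B"

lemma gdiag_carrier: "gdiag f \<in> carrier_mat n m"
  unfolding gdiag_def using U B by (simp add: mult_carrier_mat[of _ n n])

lemma gdiag_index:
  assumes "i < n" "j < m"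
  shows "gdiag f $$ (i, j) = (\<Sum>l<n. U $$ (i, l) * f l * cnj (B $$ (j, l)))"
  unfolding gdiag_def mat_diag_mult_right[OF U]
  using assms U B by (auto simp: scalar_prod_def atLeast0LessThan intro!: sum.cong)

lemma adjoint_eq_gdiag: "mat_adjoint A = gdiag (\<lambda>_. 1)"
  unfolding gdiag_def using U B
  by (subst A_eq) (simp add: mat_adjoint_mult[of _ m n _ n] right_mult_one_mat[of _ n n])

lemma gram_mult_gdiag: "mat_adjoint A * A * gdiag f = gdiag (\<lambda>i. of_real (d i) * f i)"
proof -
  note aU = mat_adjoint_carrier[OF U] and aB = mat_adjoint_carrier[OF B]
  note c = mult_carrier_mat[of _ n n]
  let ?D = "mat_diag n (\<lambda>i. of_real (d i))"
  have "mat_adjoint A * A * gdiag f = U * ?D * (mat_adjoint U * U) * mat_diag n f * mat_adjoint B"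
    unfolding gram gdiag_def using U aU aB
    by (simp add: assoc_mult_mat[of _ n n _ n _ n] assoc_mult_mat[of _ n n _ n _ m] c)
  also have "\<dots> = U * (?D * mat_diag n f) * mat_adjoint B"
    unfolding unitary using U
    by (simp add: assoc_mult_mat[of _ n n _ n _ n] c right_mult_one_mat[of _ n n] del: mat_diag_diag)
  finally show ?thesis by (simp add: gdiag_def)
qed

text \<open>Since \<open>1 / 0 = 0\<close>, this is the diagonal of the pseudoinverse of
  \<open>D\<close>, without a case distinction.\<close>

definition dinv where "dinv i = complex_of_real (1 / d i)"

lemma cnj_dinv [simp]: "cnj (dinv i) = dinv i"
  by (simp add: dinv_def)

lemma gdiag_mult_A: "gdiag f * A = U * mat_diag n (\<lambda>i. f i * of_real (d i)) * mat_adjoint U"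
proof -
  note aU = mat_adjoint_carrier[OF U] and aB = mat_adjoint_carrier[OF B]
  note c = mult_carrier_mat[of _ n n]
  have "gdiag f * A = U * mat_diag n f * (mat_adjoint B * B) * mat_adjoint U"
    unfolding gdiag_def using U B aU aB
    by (subst A_eq) (simp add: assoc_mult_mat[of _ n n _ n _ n] assoc_mult_mat[of _ n n _ n _ m]
        assoc_mult_mat[of _ n n _ m _ n] assoc_mult_mat[of _ n m _ n _ n] c mult_carrier_mat[of _ n m])
  then show ?thesis unfolding gram_B using U
    by (simp add: assoc_mult_mat[of _ n n _ n _ n] c)
qed

lemma B_mult_mat_diag:
  assumes "\<And>i. i < n \<Longrightarrow> d i \<noteq> 0 \<Longrightarrow> f i = 1"
  shows "B * mat_diag n f = B"
  unfolding mat_diag_mult_right[OF B]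
proof (rule eq_matI)
  fix l i assume "l < dim_row B" "i < dim_col B"
  then show "mat m n (\<lambda>(l, i). B $$ (l, i) * f i) $$ (l, i) = B $$ (l, i)"
    using B assms[of i] B_zero[of i l] by (cases "d i = 0") auto
qed (use B in auto)

text \<open>\<open>?P\<close> is the 0/1 diagonal marking the nonzero eigenvalues. It fixes
  \<open>B\<close>, whose other columns vanish, and \<open>dinv i * d i * dinv i = dinv i\<close>
  holds for \<open>d i = 0\<close> as well. The two products are Hermitian because they are
  conjugates of real diagonal matrices by \<open>U\<close> and by \<open>B\<close>.\<close>

lemma is_moore_penrose_inverse_gdiag: "is_moore_penrose_inverse A (gdiag dinv)"
proof -
  note aU = mat_adjoint_carrier[OF U] and aB = mat_adjoint_carrier[OF B]
  note c = mult_carrier_mat[of _ n n] and G = gdiag_carrier[of dinv]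
  let ?P = "mat_diag n (\<lambda>i. dinv i * of_real (d i))"
  have XA: "gdiag dinv * A = U * ?P * mat_adjoint U" by (rule gdiag_mult_A)
  have one: "dinv i * of_real (d i) = 1" if "d i \<noteq> 0" for i using that by (simp add: dinv_def)
  have "A * gdiag dinv * A = A * (U * ?P * mat_adjoint U)"
    using assoc_mult_mat[OF A G A] XA by simp
  also have "\<dots> = B * ?P * mat_adjoint U"
    unfolding B_def using A U
    by (simp add: assoc_mult_mat[of _ n n _ n _ n] assoc_mult_mat[of _ m n _ n _ n] c mult_carrier_mat[of _ m n])
  also have "\<dots> = A" using B_mult_mat_diag[of "\<lambda>i. dinv i * of_real (d i)"] one A_eq by simp
  finally have 1: "A * gdiag dinv * A = A" .
  have "gdiag dinv * A * gdiag dinv = U * ?P * (mat_adjoint U * U) * mat_diag n dinv * mat_adjoint B"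
    unfolding XA unfolding gdiag_def using U aU aB
    by (simp add: assoc_mult_mat[of _ n n _ n _ n] assoc_mult_mat[of _ n n _ n _ m] c)
  also have "\<dots> = U * (?P * mat_diag n dinv) * mat_adjoint B"
    unfolding unitary using U
    by (simp add: assoc_mult_mat[of _ n n _ n _ n] c right_mult_one_mat[of _ n n] del: mat_diag_diag)
  also have "?P * mat_diag n dinv = mat_diag n dinv"
  proof -
    have "dinv i * of_real (d i) * dinv i = dinv i" for i by (cases "d i = 0") (simp_all add: dinv_def)
    then show ?thesis by (simp only: mat_diag_diag)
  qed
  finally have 2: "gdiag dinv * A * gdiag dinv = gdiag dinv" by (simp add: gdiag_def)
  have "A * gdiag dinv = B * (mat_adjoint U * U) * mat_diag n dinv * mat_adjoint B"
    unfolding gdiag_def using U B aU aB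
    by (subst A_eq) (simp add: assoc_mult_mat[of _ m n _ n _ n] assoc_mult_mat[of _ n n _ n _ n]
        assoc_mult_mat[of _ n n _ n _ m] assoc_mult_mat[of _ m n _ n _ m] c mult_carrier_mat[of _ m n])
  then have AX: "A * gdiag dinv = B * mat_diag n dinv * mat_adjoint B"
    unfolding unitary using B by (simp add: right_mult_one_mat[of _ m n])
  have 3: "mat_adjoint (A * gdiag dinv) = A * gdiag dinv"
    unfolding AX using B
    by (simp add: mat_adjoint_mult[of _ m n _ m] mat_adjoint_mult[of _ n n _ m] mat_adjoint_mult[of _ m n _ n] mat_adjoint_mat_diag
        assoc_mult_mat[of _ m n _ n _ m] mult_carrier_mat[of _ m n] c)
  have 4: "mat_adjoint (gdiag dinv * A) = gdiag dinv * A"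
    unfolding XA using U
    by (simp add: mat_adjoint_mult[of _ n n _ n] mat_adjoint_mat_diag
        assoc_mult_mat[of _ n n _ n _ n] c)
  show ?thesis unfolding is_moore_penrose_inverse_def using 1 2 3 4 G A by simp
qed

lemma moore_penrose_inverse_eq: "moore_penrose_inverse A = gdiag dinv"
  by (rule moore_penrose_inverse_eqI[OF is_moore_penrose_inverse_gdiag])

text \<open>The inner factor \<open>B\<close> enters only through its Gram matrix, so
  \<open>dinv * d * dinv = dinv\<close> remains between \<open>U\<close> and its adjoint, and the
  trace is cyclic.\<close>

lemma frobenius_sq_moore_penrose_inverse:
  "frobenius_sq (moore_penrose_inverse A) = (\<Sum>i<n. 1 / d i)"
proof -
  note aU = mat_adjoint_carrier[OF U] and aB = mat_adjoint_carrier[OF B]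
  note c = mult_carrier_mat[of _ n n]
  let ?G = "mat_diag n dinv"
  have "gdiag dinv * mat_adjoint (gdiag dinv) = U * (?G * (mat_adjoint B * B) * ?G) * mat_adjoint U"
    unfolding gdiag_def using U B aU aB
    by (simp add: mat_adjoint_mult[of _ n n _ m] mat_adjoint_mult[of _ n n _ n] mat_adjoint_mat_diag
       assoc_mult_mat[of _ n n _ n _ n] assoc_mult_mat[of _ n n _ n _ m] assoc_mult_mat[of _ n n _ m _ n]
       assoc_mult_mat[of _ n m _ n _ n] c mult_carrier_mat[of _ n m] mult_carrier_mat[of _ m n])
  also have "?G * (mat_adjoint B * B) * ?G = ?G"
  proof -
    have "dinv i * of_real (d i) * dinv i = dinv i" for i by (cases "d i = 0") (simp_all add: dinv_def)
    then show ?thesis unfolding gram_B by (simp only: mat_diag_diag)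
  qed
  finally have "complex_of_real (frobenius_sq (gdiag dinv)) = mat_tr (U * (?G * mat_adjoint U))"
    unfolding frobenius_sq_eq_tr using U by (simp add: assoc_mult_mat[of _ n n _ n _ n])
  also have "\<dots> = mat_tr (?G * mat_adjoint U * U)"
    using U by (intro mat_tr_commute) (auto simp: c)
  also have "\<dots> = mat_tr (?G * (mat_adjoint U * U))"
    using U by (simp add: assoc_mult_mat[of _ n n _ n _ n])
  also have "\<dots> = complex_of_real (\<Sum>i<n. 1 / d i)"
    unfolding unitary by (simp add: right_mult_one_mat[of _ n n] mat_tr_mat_diag dinv_def)
  finally show ?thesis unfolding moore_penrose_inverse_eq of_real_eq_iff .
qed

lemma frobenius_sq_unitary_conj:
  "frobenius_sq (U * mat_diag n f * mat_adjoint U) = (\<Sum>i<n. (cmod (f i))\<^sup>2)"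
proof -
  note aU = mat_adjoint_carrier[OF U]
  note c = mult_carrier_mat[of _ n n]
  let ?M = "U * mat_diag n f * mat_adjoint U"
  have "?M * mat_adjoint ?M = U * (mat_diag n f * (mat_adjoint U * U) * mat_diag n (\<lambda>i. cnj (f i))) * mat_adjoint U"
    using U aU by (simp add: mat_adjoint_mult[of _ n n _ n] mat_adjoint_mat_diag assoc_mult_mat[of _ n n _ n _ n] c)
  also have "\<dots> = U * (mat_diag n (\<lambda>i. f i * cnj (f i)) * mat_adjoint U)"
    unfolding unitary using U aU by (simp add: right_mult_one_mat[of _ n n] assoc_mult_mat[of _ n n _ n _ n])
  finally have "complex_of_real (frobenius_sq ?M) = mat_tr (U * (mat_diag n (\<lambda>i. f i * cnj (f i)) * mat_adjoint U))"
    unfolding frobenius_sq_eq_tr by simp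
  also have "\<dots> = mat_tr (mat_diag n (\<lambda>i. f i * cnj (f i)) * mat_adjoint U * U)"
    using U by (intro mat_tr_commute) (auto simp: c)
  also have "\<dots> = mat_tr (mat_diag n (\<lambda>i. f i * cnj (f i)) * (mat_adjoint U * U))"
    using U by (simp add: assoc_mult_mat[of _ n n _ n _ n])
  also have "\<dots> = complex_of_real (\<Sum>i<n. (cmod (f i))\<^sup>2)"
    unfolding unitary of_real_sum complex_norm_square
    by (simp add: right_mult_one_mat[of _ n n] mat_tr_mat_diag)
  finally show ?thesis unfolding of_real_eq_iff .
qed

text \<open>After writing the identity as a conjugate by \<open>U\<close> as well, the difference is
  diagonal with entry -1 exactly at the zero eigenvalues; the squared norm counts them.\<close>

lemma frobenius_sq_residual:
  "frobenius_sq (moore_penrose_inverse A * A - 1\<^sub>m n) = real n - real (card {i. i < n \<and> d i \<noteq> 0})"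
proof -
  note c = mult_carrier_mat[of _ n n]
  let ?f = "\<lambda>i. dinv i * of_real (d i)"
  have "moore_penrose_inverse A * A - 1\<^sub>m n = U * mat_diag n ?f * mat_adjoint U - U * mat_diag n (\<lambda>_. 1) * mat_adjoint U"
    using U by (simp add: moore_penrose_inverse_eq gdiag_mult_A unitary' right_mult_one_mat[of _ n n])
  also have "\<dots> = U * (mat_diag n ?f - mat_diag n (\<lambda>_. 1)) * mat_adjoint U"
    unfolding mult_minus_distrib_mat[OF U mat_diag_dim mat_diag_dim]
      minus_mult_distrib_mat[OF mult_carrier_mat[OF U mat_diag_dim] mult_carrier_mat[OF U mat_diag_dim] mat_adjoint_carrier[OF U]] ..
  also have "mat_diag n ?f - mat_diag n (\<lambda>_. 1) = mat_diag n (\<lambda>i. if d i = 0 then - 1 else 0)"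
    by (intro eq_matI) (auto simp: mat_diag_def dinv_def)
  finally have "frobenius_sq (moore_penrose_inverse A * A - 1\<^sub>m n) =
      (\<Sum>i<n. (cmod (if d i = 0 then - 1 else 0))\<^sup>2)"
    by (simp only: frobenius_sq_unitary_conj)
  also have "\<dots> = (\<Sum>i<n. 1 - (if d i \<noteq> 0 then 1 else 0))" by (intro sum.cong) auto
  also have "\<dots> = real n - real (card {i. i < n \<and> d i \<noteq> 0})"
    by (simp add: sum_subtractf sum.If_cases Int_def)
  finally show ?thesis .
qed

text \<open>The nonzero columns of \<open>B\<close> form a matrix \<open>C\<close> of full column
  rank \<open>k\<close>. As \<open>C\<close> and \<open>A\<close> are right multiples of each other,
  they have the same rank.\<close>

lemma matrix_rank_eq: "matrix_rank A = card {i. i < n \<and> d i \<noteq> 0}"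
proof -
  interpret vec_space "TYPE(complex)" m .
  define I where "I = filter (\<lambda>i. d i \<noteq> 0) [0..<n]"
  define k where "k = length I"
  have I: "I ! j < n" "d (I ! j) \<noteq> 0" if "j < k" for j
    using nth_mem[of j I] that unfolding k_def by (auto simp: I_def)
  have distI: "distinct I" by (simp add: I_def)
  have setI: "set I = {i. i < n \<and> d i \<noteq> 0}" by (auto simp: I_def)
  have k: "k = card {i. i < n \<and> d i \<noteq> 0}" unfolding k_def setI[symmetric] distinct_card[OF distI] ..
  define C where "C = mat m k (\<lambda>(l, j). B $$ (l, I ! j))"
  \<comment> \<open>\<open>Z\<close> keeps the columns of \<open>U\<close> with nonzero eigenvalue
    and \<open>Y\<close> is its adjoint; they are the right factors in \<open>C = A * Z\<close> and
    \<open>A = C * Y\<close>.\<close>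
  define Z where "Z = mat n k (\<lambda>(l, j). U $$ (l, I ! j))"
  define Y where "Y = mat k n (\<lambda>(j, l). cnj (U $$ (l, I ! j)))"
  have C: "C \<in> carrier_mat m k" and Z: "Z \<in> carrier_mat n k" and Y: "Y \<in> carrier_mat k n"
    by (auto simp: C_def Z_def Y_def)
  have "mat_adjoint C * C = mat_diag k (\<lambda>j. of_real (d (I ! j)))"
  proof (rule eq_matI)
    fix i j assume "i < dim_row (mat_diag k (\<lambda>j. complex_of_real (d (I ! j))))"
      "j < dim_col (mat_diag k (\<lambda>j. complex_of_real (d (I ! j))))"
    then have ij: "i < k" "j < k" by (auto simp: mat_diag_def)
    have "(mat_adjoint C * C) $$ (i, j) = (\<Sum>l<m. cnj (B $$ (l, I ! i)) * B $$ (l, I ! j))"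
      using ij by (subst adjoint_mult_self_eq_gram[OF C]) (auto simp: C_def)
    also have "\<dots> = (mat_adjoint B * B) $$ (I ! i, I ! j)"
      using I ij by (subst adjoint_mult_self_eq_gram[OF B]) auto
    also have "\<dots> = mat_diag k (\<lambda>j. of_real (d (I ! j))) $$ (i, j)"
      unfolding gram_B using I ij distI by (simp add: mat_diag_def k_def nth_eq_iff_index_eq)
    finally show "(mat_adjoint C * C) $$ (i, j) = mat_diag k (\<lambda>j. of_real (d (I ! j))) $$ (i, j)" .
  qed (use C in \<open>auto simp: mat_diag_def\<close>)
  then have rC: "rank C = k" using I by (intro rank_orthogonal_cols[OF C]) auto
  have "C = A * Z"
    using A Z U I unfolding C_def B_def
    by (intro eq_matI) (auto simp: Z_def scalar_prod_def intro!: sum.cong)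
  moreover have "A = C * Y"
  proof (rule eq_matI)
    fix l i assume "l < dim_row (C * Y)" "i < dim_col (C * Y)"
    then have li: "l < m" "i < n" using C Y by auto
    have "(C * Y) $$ (l, i) = (\<Sum>j<k. B $$ (l, I ! j) * cnj (U $$ (i, I ! j)))"
      using li by (auto simp: C_def Y_def scalar_prod_def atLeast0LessThan intro!: sum.cong)
    also have "\<dots> = (\<Sum>c\<in>set I. B $$ (l, c) * cnj (U $$ (i, c)))"
      using sum.reindex_bij_betw[OF bij_betw_nth[OF distI k_def[THEN arg_cong[of _ _ lessThan]] refl]] .
    \<comment> \<open>The indices missing from \<open>I\<close> belong to zero columns of
      \<open>B\<close>.\<close>
    also have "\<dots> = (\<Sum>c<n. B $$ (l, c) * cnj (U $$ (i, c)))"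
      using B_zero li unfolding setI by (intro sum.mono_neutral_left) auto
    also have "\<dots> = A $$ (l, i)"
      using li U B by (subst A_eq) (auto simp: scalar_prod_def atLeast0LessThan intro!: sum.cong)
    finally show "A $$ (l, i) = (C * Y) $$ (l, i)" ..
  qed (use A C Y in auto)
  ultimately have "rank A = rank C"
    using rank_mult_le[OF A Z] rank_mult_le[OF C Y] by simp
  then show ?thesis unfolding matrix_rank_def rC k using A by simp
qed

text \<open>Similar matrices share the characteristic polynomial, and \<open>proots\<close> counts
  roots with multiplicity, so repeated eigenvalues are repeated in the list.\<close>

lemma singular_values_eq: "singular_values A = rev (sort (map (\<lambda>i. sqrt (d i)) [0..<n]))"
proof -
  let ?D = "mat_diag n (\<lambda>i. complex_of_real (d i))"
  have "similar_mat (mat_adjoint A * A) ?D"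
    using U A unitary unitary' gram
    by (intro similar_matI[of _ _ U "mat_adjoint U" n]) auto
  then have "char_poly (mat_adjoint A * A) = char_poly ?D" by (rule char_poly_similar)
  also have "\<dots> = (\<Prod>a\<leftarrow>diag_mat ?D. [:- a, 1:])"
    by (rule char_poly_upper_triangular[OF mat_diag_dim]) (auto simp: mat_diag_def)
  also have "diag_mat ?D = map (\<lambda>i. of_real (d i)) [0..<n]"
    by (auto simp: diag_mat_def mat_diag_def)
  finally have cp: "char_poly (mat_adjoint A * A) = (\<Prod>i\<leftarrow>[0..<n]. [:- complex_of_real (d i), 1:])"
    by (simp add: o_def)
  have "proots (\<Prod>i\<leftarrow>is. [:- complex_of_real (d i), 1:]) = mset (map (\<lambda>i. complex_of_real (d i)) is)" for "is"
  proof (induction "is")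
    case (Cons i "is")
    have "(\<Prod>i\<leftarrow>is. [:- complex_of_real (d i), 1:]) \<noteq> 0" by (auto simp: prod_list_zero_iff)
    then show ?case using Cons by (simp add: proots_mult del: mult_pCons_left)
  qed simp
  then have "image_mset (\<lambda>z. sqrt (Re z)) (proots (char_poly (mat_adjoint A * A))) =
      mset (map (\<lambda>i. sqrt (d i)) [0..<n])"
    unfolding cp by (simp add: o_def image_mset.compositionality multiset.map_comp)
  then show ?thesis unfolding singular_values_def by (simp only: sorted_list_of_multiset_mset)
qed

text \<open>By monotonicity the nonzero singular values are the first \<open>matrix_rank A\<close>
  ones. The padding zeros contribute \<open>1 / 0 = 0\<close>, and the full sum does not depend on
  the order.\<close>

lemma sum_inverse_singular_values:
  "(\<Sum>i = 1..matrix_rank A. 1 / (singular_value A i)\<^sup>2) = (\<Sum>i<n. 1 / d i)"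
proof -
  define L where "L = singular_values A"
  let ?xs = "map (\<lambda>i. sqrt (d i)) [0..<n]"
  have mL: "mset L = mset ?xs" by (simp add: L_def singular_values_eq)
  have lenL: "length L = n" by (simp add: L_def singular_values_eq)
  have "set L = set ?xs" using mset_eq_setD[OF mL] .
  then have nn: "0 \<le> x" if "x \<in> set L" for x using that d_nonneg by auto
  have dec: "sorted_wrt (\<ge>) L"
    unfolding L_def singular_values_eq sorted_wrt_rev by simp
  have "length (filter (\<lambda>x. x \<noteq> 0) L) = length (filter (\<lambda>x. x \<noteq> 0) ?xs)"
    using mL by (metis mset_filter size_mset)
  also have "\<dots> = card {i. i < n \<and> d i \<noteq> 0}"
    by (simp add: filter_map o_def length_filter_conv_card cong: conj_cong)
  finally have r: "length (filter (\<lambda>x. x \<noteq> 0) L) = matrix_rank A" by (simp add: matrix_rank_eq)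
  have "(\<Sum>i = 1..matrix_rank A. 1 / (singular_value A i)\<^sup>2) = (\<Sum>i<matrix_rank A. 1 / (L ! i)\<^sup>2)"
    unfolding singular_value_def L_def[symmetric]
    by (rule sum.reindex_bij_witness[of _ Suc "\<lambda>i. i - 1"]) auto
  also have "\<dots> = (\<Sum>i<n. 1 / (L ! i)\<^sup>2)"
  proof (rule sum.mono_neutral_left)
    show "{..<matrix_rank A} \<subseteq> {..<n}"
      unfolding r[symmetric] lenL[symmetric] using length_filter_le by auto
    show "\<forall>i\<in>{..<n} - {..<matrix_rank A}. 1 / (L ! i)\<^sup>2 = 0"
      using decreasing_nonneg_nth_zero[OF dec nn, unfolded r lenL] by auto
  qed auto
  also have "\<dots> = sum_list (map (\<lambda>x. 1 / x\<^sup>2) L)"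
    by (simp add: sum_list_sum_nth lenL atLeast0LessThan)
  also have "\<dots> = sum_list (map (\<lambda>x. 1 / x\<^sup>2) ?xs)"
    unfolding sum_mset_sum_list[symmetric] mset_map mL ..
  also have "\<dots> = (\<Sum>i<n. 1 / (sqrt (d i))\<^sup>2)"
    by (simp add: sum_list_sum_nth atLeast0LessThan)
  also have "\<dots> = (\<Sum>i<n. 1 / d i)" using d_nonneg by (intro sum.cong) auto
  finally show ?thesis .
qed

end

section \<open>Measurability of the Moore-Penrose inverse\<close>

text \<open>Gradient descent from 0 for half the squared Frobenius norm of
  \<open>A * X - 1\<close>.\<close>

primrec landweber :: "real \<Rightarrow> complex mat \<Rightarrow> nat \<Rightarrow> complex mat" where
  "landweber s A 0 = 0\<^sub>m (dim_col A) (dim_row A)"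
| "landweber s A (Suc k) = landweber s A k +
     complex_of_real s \<cdot>\<^sub>m (mat_adjoint A - mat_adjoint A * A * landweber s A k)"

text \<open>What the iteration does to one eigenvalue \<open>x\<close> of the Gram matrix.\<close>

primrec landweber_filter :: "real \<Rightarrow> nat \<Rightarrow> real \<Rightarrow> real" where
  "landweber_filter s 0 x = 0"
| "landweber_filter s (Suc k) x = landweber_filter s k x + s * (1 - x * landweber_filter s k x)"

text \<open>Each step multiplies the residual \<open>1 - x * landweber_filter s k x\<close> by
  \<open>1 - s * x\<close>. The form multiplied by \<open>x\<close> covers
  \<open>x = 0\<close>.\<close>

lemma mult_landweber_filter: "x * landweber_filter s k x = 1 - (1 - s * x) ^ k"
proof (induction k)
  case (Suc k)
  have "x * landweber_filter s (Suc k) x =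
      x * landweber_filter s k x + s * x * (1 - x * landweber_filter s k x)"
    by (simp add: algebra_simps)
  then show ?case unfolding Suc.IH by (simp add: algebra_simps)
qed simp

lemma landweber_filter_eq:
  "x \<noteq> 0 \<Longrightarrow> landweber_filter s k x = (1 - (1 - s * x) ^ k) / x"
  by (simp add: mult_landweber_filter[symmetric])

text \<open>The assumptions put \<open>1 - s * x\<close> in the interval from 0 (included) to 1
  (excluded), so its powers vanish in the limit.\<close>

lemma landweber_filter_tendsto:
  assumes "0 < s" "0 < x" "s * x \<le> 1"
  shows "(\<lambda>k. landweber_filter s k x) \<longlonglongrightarrow> 1 / x"
proof -
  have "(\<lambda>k. (1 - (1 - s * x) ^ k) / x) \<longlonglongrightarrow> (1 - 0) / x"
    using assms by (intro tendsto_intros LIMSEQ_power_zero) auto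
  then show ?thesis using assms by (simp add: landweber_filter_eq)
qed

context gram_diagonalization
begin

lemma landweber_eq_gdiag:
  "landweber s A k = gdiag (\<lambda>l. of_real (landweber_filter s k (d l)))"
proof (induction k)
  case 0
  show ?case
    using gdiag_carrier[of "\<lambda>_. 0"] A by (intro eq_matI) (auto simp: gdiag_index)
next
  case (Suc k)
  let ?g = "\<lambda>l. complex_of_real (landweber_filter s k (d l))"
  have "landweber s A (Suc k) =
      gdiag ?g + complex_of_real s \<cdot>\<^sub>m (gdiag (\<lambda>_. 1) - gdiag (\<lambda>l. of_real (d l) * ?g l))"
    by (simp add: Suc.IH gram_mult_gdiag adjoint_eq_gdiag[symmetric])
  also have "\<dots> = gdiag (\<lambda>l. of_real (landweber_filter s (Suc k) (d l)))"
  proof (rule eq_matI)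
    fix i j assume "i < dim_row (gdiag (\<lambda>l. of_real (landweber_filter s (Suc k) (d l))))"
      "j < dim_col (gdiag (\<lambda>l. of_real (landweber_filter s (Suc k) (d l))))"
    then have ij: "i < n" "j < m" using gdiag_carrier by (metis carrier_matD)+
    then show "(gdiag ?g + complex_of_real s \<cdot>\<^sub>m (gdiag (\<lambda>_. 1) - gdiag (\<lambda>l. of_real (d l) * ?g l))) $$ (i, j) =
        gdiag (\<lambda>l. of_real (landweber_filter s (Suc k) (d l))) $$ (i, j)"
      using carrier_matD[OF gdiag_carrier]
      by (simp add: gdiag_index sum_distrib_left sum.distrib[symmetric] sum_subtractf[symmetric] algebra_simps)
  qed (use carrier_matD[OF gdiag_carrier] in auto)
  finally show ?case .
qed

text \<open>Where \<open>d l = 0\<close> the filter diverges, but there the column \<open>l\<close> of \<open>B\<close> vanishes.\<close>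

lemma landweber_tendsto:
  assumes s: "0 < s" "s * frobenius_sq A \<le> 1" and ij: "i < n" "j < m"
  shows "(\<lambda>k. landweber s A k $$ (i, j)) \<longlonglongrightarrow> moore_penrose_inverse A $$ (i, j)"
  unfolding landweber_eq_gdiag moore_penrose_inverse_eq gdiag_index[OF ij]
proof (intro tendsto_sum)
  fix l assume l: "l \<in> {..<n}"
  show "(\<lambda>k. U $$ (i, l) * of_real (landweber_filter s k (d l)) * cnj (B $$ (j, l)))
      \<longlonglongrightarrow> U $$ (i, l) * dinv l * cnj (B $$ (j, l))"
  proof (cases "d l = 0")
    case True
    then show ?thesis using B_zero[of l j] l ij by simp
  next
    case False
    have "d l \<le> frobenius_sq A"
      unfolding sum_d_eq[symmetric] using l d_nonneg by (intro member_le_sum) auto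
    then have "s * d l \<le> 1" using s by (meson mult_left_mono less_imp_le order_trans)
    then have "(\<lambda>k. landweber_filter s k (d l)) \<longlonglongrightarrow> 1 / d l"
      using False d_nonneg[of l] l s by (intro landweber_filter_tendsto) auto
    then show ?thesis unfolding dinv_def by (intro tendsto_intros)
  qed
qed

end

section \<open>Random matrices with measurable entries\<close>

lemma landweber_carrier: "A \<in> carrier_mat m n \<Longrightarrow> landweber s A k \<in> carrier_mat n m"
  by (induction k) auto

lemma borel_measurable_mat_mult:
  assumes "\<And>\<omega>. \<omega> \<in> space M \<Longrightarrow> A \<omega> \<in> carrier_mat m k" "\<And>\<omega>. \<omega> \<in> space M \<Longrightarrow> C \<omega> \<in> carrier_mat k n"
    and "\<And>i j. i < m \<Longrightarrow> j < k \<Longrightarrow> (\<lambda>\<omega>. A \<omega> $$ (i, j) :: complex) \<in> borel_measurable M"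
    and "\<And>i j. i < k \<Longrightarrow> j < n \<Longrightarrow> (\<lambda>\<omega>. C \<omega> $$ (i, j)) \<in> borel_measurable M"
    and "i < m" "j < n"
  shows "(\<lambda>\<omega>. (A \<omega> * C \<omega>) $$ (i, j)) \<in> borel_measurable M"
proof -
  have "(\<lambda>\<omega>. \<Sum>l<k. A \<omega> $$ (i, l) * C \<omega> $$ (l, j)) \<in> borel_measurable M"
    using assms(3,4,5,6) by (intro borel_measurable_sum borel_measurable_times) auto
  then show ?thesis
  proof (rule measurable_cong[THEN iffD1, rotated])
    fix \<omega> assume "\<omega> \<in> space M"
    then show "(\<Sum>l<k. A \<omega> $$ (i, l) * C \<omega> $$ (l, j)) = (A \<omega> * C \<omega>) $$ (i, j)"
      using assms(1,2)[of \<omega>] assms(5,6)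
      by (auto simp: scalar_prod_def atLeast0LessThan intro!: sum.cong)
  qed
qed

lemma borel_measurable_mat_adjoint:
  fixes A :: "'w \<Rightarrow> complex mat"
  assumes "\<And>\<omega>. \<omega> \<in> space M \<Longrightarrow> A \<omega> \<in> carrier_mat m n"
    and "\<And>i j. i < m \<Longrightarrow> j < n \<Longrightarrow> (\<lambda>\<omega>. A \<omega> $$ (i, j)) \<in> borel_measurable M"
    and "i < n" "j < m"
  shows "(\<lambda>\<omega>. mat_adjoint (A \<omega>) $$ (i, j)) \<in> borel_measurable M"
proof -
  have "(\<lambda>\<omega>. cnj (A \<omega> $$ (j, i))) \<in> borel_measurable M"
    using assms(2)[OF assms(4,3)]
    by (rule measurable_compose) (intro borel_measurable_continuous_onI continuous_intros)
  moreover have "mat_adjoint (A \<omega>) $$ (i, j) = cnj (A \<omega> $$ (j, i))" if "\<omega> \<in> space M" for \<omega>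
    using assms(1)[OF that] assms(3,4) by simp
  ultimately show ?thesis by (simp cong: measurable_cong)
qed

lemma borel_measurable_landweber:
  assumes A: "\<And>\<omega>. \<omega> \<in> space M \<Longrightarrow> A \<omega> \<in> carrier_mat m n"
    and meas: "\<And>i j. i < m \<Longrightarrow> j < n \<Longrightarrow> (\<lambda>\<omega>. A \<omega> $$ (i, j)) \<in> borel_measurable M"
    and ij: "i < n" "j < m"
  shows "(\<lambda>\<omega>. landweber s (A \<omega>) k $$ (i, j)) \<in> borel_measurable M"
  using ij
proof (induction k arbitrary: i j)
  case 0
  have "landweber s (A \<omega>) 0 $$ (i, j) = 0" if "\<omega> \<in> space M" for \<omega>
    using A[OF that] 0 by simp
  then show ?case by (subst measurable_cong[where g = "\<lambda>_. 0"]) simp_all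
next
  case (Suc k)
  note L = landweber_carrier[OF A, of _ s k]
  have adj: "(\<lambda>\<omega>. mat_adjoint (A \<omega>) $$ (i, j)) \<in> borel_measurable M" if "i < n" "j < m" for i j
    by (rule borel_measurable_mat_adjoint[OF A meas that])
  have aA: "mat_adjoint (A \<omega>) \<in> carrier_mat n m" if "\<omega> \<in> space M" for \<omega>
    using A[OF that] by simp
  have H: "(\<lambda>\<omega>. (mat_adjoint (A \<omega>) * A \<omega>) $$ (i, j)) \<in> borel_measurable M" if "i < n" "j < n" for i j
    by (rule borel_measurable_mat_mult[OF aA A adj meas that])
  have aAA: "mat_adjoint (A \<omega>) * A \<omega> \<in> carrier_mat n n" if "\<omega> \<in> space M" for \<omega>
    using mult_carrier_mat[OF aA A, OF that that] .
  have HL: "(\<lambda>\<omega>. (mat_adjoint (A \<omega>) * A \<omega> * landweber s (A \<omega>) k) $$ (i, j)) \<in> borel_measurable M"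
    by (rule borel_measurable_mat_mult[OF aAA L H Suc.IH Suc.prems])
  have "(\<lambda>\<omega>. landweber s (A \<omega>) k $$ (i, j) + complex_of_real s *
      (mat_adjoint (A \<omega>) $$ (i, j) - (mat_adjoint (A \<omega>) * A \<omega> * landweber s (A \<omega>) k) $$ (i, j)))
      \<in> borel_measurable M"
    using Suc.IH[OF Suc.prems] HL adj[OF Suc.prems] by measurable
  then show ?case
  proof (rule measurable_cong[THEN iffD1, rotated])
    fix \<omega> assume w: "\<omega> \<in> space M"
    show "landweber s (A \<omega>) k $$ (i, j) + complex_of_real s *
      (mat_adjoint (A \<omega>) $$ (i, j) - (mat_adjoint (A \<omega>) * A \<omega> * landweber s (A \<omega>) k) $$ (i, j)) =
      landweber s (A \<omega>) (Suc k) $$ (i, j)"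
      using Suc.prems A[OF w] L[OF w] aAA[OF w] by (simp del: index_mult_mat(1))
  qed
qed

text \<open>A pointwise limit of measurable functions. \<open>U\<close> and \<open>d\<close> are
  obtained separately at each \<open>\<omega>\<close>, so nothing is required of their dependence on
  \<open>\<omega>\<close>.\<close>

lemma borel_measurable_moore_penrose_inverse:
  assumes A: "\<And>\<omega>. \<omega> \<in> space M \<Longrightarrow> A \<omega> \<in> carrier_mat m n"
    and meas: "\<And>i j. i < m \<Longrightarrow> j < n \<Longrightarrow> (\<lambda>\<omega>. A \<omega> $$ (i, j)) \<in> borel_measurable M"
    and bound: "\<And>\<omega>. \<omega> \<in> space M \<Longrightarrow> frobenius_sq (A \<omega>) \<le> c"
    and ij: "i < n" "j < m"
  shows "(\<lambda>\<omega>. moore_penrose_inverse (A \<omega>) $$ (i, j)) \<in> borel_measurable M"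
proof -
  \<comment> \<open>\<open>\<bar>c\<bar> + 1\<close> is positive and exceeds \<open>c\<close> for
    every real \<open>c\<close>, so one step size serves all \<open>\<omega>\<close>.\<close>
  define s where "s = 1 / (\<bar>c\<bar> + 1)"
  have s: "0 < s" by (simp add: s_def)
  show ?thesis
  proof (rule borel_measurable_LIMSEQ_metric[where f = "\<lambda>k \<omega>. landweber s (A \<omega>) k $$ (i, j)"])
    show "(\<lambda>\<omega>. landweber s (A \<omega>) k $$ (i, j)) \<in> borel_measurable M" for k
      by (rule borel_measurable_landweber[OF A meas ij])
    fix \<omega> assume w: "\<omega> \<in> space M"
    obtain U d where "gram_diagonalization (A \<omega>) U m n d"
      using gram_diagonalization_exists[OF A[OF w]] .
    then interpret gram_diagonalization "A \<omega>" U m n d .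
    have "s * frobenius_sq (A \<omega>) \<le> 1" using bound[OF w] by (simp add: s_def field_simps)
    then show "(\<lambda>k. landweber s (A \<omega>) k $$ (i, j)) \<longlonglongrightarrow> moore_penrose_inverse (A \<omega>) $$ (i, j)"
      using s ij by (intro landweber_tendsto)
  qed
qed

lemma moore_penrose_inverse_carrier:
  assumes "A \<in> carrier_mat m n"
  shows "moore_penrose_inverse A \<in> carrier_mat n m"
proof -
  obtain U d where "gram_diagonalization A U m n d" using gram_diagonalization_exists[OF assms] .
  then interpret gram_diagonalization A U m n d .
  show ?thesis unfolding moore_penrose_inverse_eq by (rule gdiag_carrier)
qed

lemma frobenius_sq_moore_penrose_inverse:
  assumes "A \<in> carrier_mat m n"
  shows "frobenius_sq (moore_penrose_inverse A) =
    (\<Sum>i = 1..matrix_rank A. 1 / (singular_value A i)\<^sup>2)"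
proof -
  obtain U d where "gram_diagonalization A U m n d" using gram_diagonalization_exists[OF assms] .
  then interpret gram_diagonalization A U m n d .
  show ?thesis unfolding frobenius_sq_moore_penrose_inverse sum_inverse_singular_values ..
qed

lemma frobenius_sq_moore_penrose_residual:
  assumes "A \<in> carrier_mat m n"
  shows "frobenius_sq (moore_penrose_inverse A * A - 1\<^sub>m n) = real n - real (matrix_rank A)"
proof -
  obtain U d where "gram_diagonalization A U m n d" using gram_diagonalization_exists[OF assms] .
  then interpret gram_diagonalization A U m n d .
  show ?thesis unfolding frobenius_sq_residual matrix_rank_eq ..
qed

section \<open>Moments and independence\<close>

text \<open>Expand the square into a double sum; the second moments leave only its diagonal. The
  abstract index type allows signal and noise to be treated as one vector.\<close>

lemma nn_integral_norm_sq_sum: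
  fixes z :: "'i \<Rightarrow> 'w \<Rightarrow> complex" and c :: "'i \<Rightarrow> real"
  assumes I: "finite I"
    and z: "\<And>a b. a \<in> I \<Longrightarrow> b \<in> I \<Longrightarrow>
      has_bochner_integral M (\<lambda>\<omega>. z a \<omega> * cnj (z b \<omega>)) (if a = b then of_real (c a) else 0)"
  shows "(\<integral>\<^sup>+ \<omega>. ennreal ((cmod (\<Sum>a\<in>I. w a * z a \<omega>))\<^sup>2) \<partial>M) = ennreal (\<Sum>a\<in>I. (cmod (w a))\<^sup>2 * c a)"
proof -
  have "has_bochner_integral M (\<lambda>\<omega>. \<Sum>a\<in>I. \<Sum>b\<in>I. (w a * cnj (w b)) * (z a \<omega> * cnj (z b \<omega>)))
      (\<Sum>a\<in>I. \<Sum>b\<in>I. (w a * cnj (w b)) * (if a = b then of_real (c a) else 0))"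
    using z by (intro has_bochner_integral_sum has_bochner_integral_mult_right)
  also have "(\<Sum>a\<in>I. \<Sum>b\<in>I. (w a * cnj (w b)) * (if a = b then of_real (c a) else 0)) =
      complex_of_real (\<Sum>a\<in>I. (cmod (w a))\<^sup>2 * c a)"
    using I unfolding of_real_sum of_real_mult complex_norm_square
    by (intro sum.cong) (auto simp: if_distrib[where f = "\<lambda>u. _ * u"] cong: if_cong)
  also have "(\<lambda>\<omega>. \<Sum>a\<in>I. \<Sum>b\<in>I. (w a * cnj (w b)) * (z a \<omega> * cnj (z b \<omega>))) =
      (\<lambda>\<omega>. complex_of_real ((cmod (\<Sum>a\<in>I. w a * z a \<omega>))\<^sup>2))"
    unfolding complex_norm_square by (simp add: sum_product mult_ac)
  \<comment> \<open>The expansion is integrated over the complex numbers; taking real parts returns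
    to a real integrand.\<close>
  finally have "has_bochner_integral M (\<lambda>\<omega>. Re (complex_of_real ((cmod (\<Sum>a\<in>I. w a * z a \<omega>))\<^sup>2)))
      (Re (complex_of_real (\<Sum>a\<in>I. (cmod (w a))\<^sup>2 * c a)))"
    by (rule has_bochner_integral_bounded_linear[OF bounded_linear_Re])
  then have "has_bochner_integral M (\<lambda>\<omega>. (cmod (\<Sum>a\<in>I. w a * z a \<omega>))\<^sup>2) (\<Sum>a\<in>I. (cmod (w a))\<^sup>2 * c a)"
    by (simp only: Re_complex_of_real)
  then show ?thesis
    by (subst nn_integral_eq_integral) (auto simp: has_bochner_integral_iff)
qed

text \<open>The coordinates are independent, so the integral factorises. The list holds the moments
  of order 0, 1 and 2 of one coordinate; means and covariances are both special cases.\<close>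

lemma gaussian_monomial_moment:
  assumes s: "0 < s" and p: "\<And>i. i < m \<Longrightarrow> p i \<le> (2::nat)"
  shows "has_bochner_integral (isotropic_gaussian m s) (\<lambda>f. \<Prod>i<m. f i ^ p i)
    (\<Prod>i<m. [1, 0, s\<^sup>2] ! p i)"
proof -
  let ?D = "density lborel (\<lambda>z. ennreal (normal_density 0 s z))"
  interpret D: prob_space ?D by (rule prob_space_normal_density[OF s])
  interpret product_sigma_finite "\<lambda>_::nat. ?D" by standard
  have mom: "has_bochner_integral ?D (\<lambda>x. x ^ k) ([1, 0, s\<^sup>2] ! k)" if "k \<le> 2" for k
  proof -
    have "has_bochner_integral lborel (\<lambda>x. normal_density 0 s x *\<^sub>R x ^ k) ([1, 0, s\<^sup>2] ! k)"
    proof -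
      consider "k = 0" | "k = 1" | "k = 2" using \<open>k \<le> 2\<close> by linarith
      then show ?thesis
      proof cases
        case 1
        then show ?thesis using normal_moment_even[OF s, of 0 0] by simp
      next
        case 2
        then show ?thesis using normal_moment_odd[OF s, of 0 0] by simp
      next
        case 3
        have "fact 2 / ((2 / s\<^sup>2) ^ 1 * fact 1) = s\<^sup>2" using s by (simp add: fact_numeral)
        then show ?thesis using 3 normal_moment_even[OF s, of 0 1] by (simp add: numeral_2_eq_2)
      qed
    qed
    then show ?thesis
      by (intro has_bochner_integral_density) auto
  qed
  have "integrable (isotropic_gaussian m s) (\<lambda>f. \<Prod>i<m. f i ^ p i)"
    unfolding isotropic_gaussian_def
    using mom[OF p] by (intro product_integrable_prod) (auto simp: has_bochner_integral_iff)
  moreover have "integral\<^sup>L (isotropic_gaussian m s) (\<lambda>f. \<Prod>i<m. f i ^ p i) = (\<Prod>i<m. [1, 0, s\<^sup>2] ! p i)"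
    unfolding isotropic_gaussian_def
    using mom[OF p] by (subst product_integral_prod) (auto simp: has_bochner_integral_iff)
  ultimately show ?thesis by (simp add: has_bochner_integral_iff)
qed

lemma gaussian_mean:
  assumes "0 < s" "k < m"
  shows "has_bochner_integral (isotropic_gaussian m s) (\<lambda>f. f k) 0"
proof -
  have "(\<Prod>i<m. f i ^ (if i = k then 1 else 0)) = f k" for f :: "nat \<Rightarrow> real"
    using assms(2) by (simp add: if_distrib[where f="\<lambda>x. _ ^ x"] cong: if_cong)
  moreover have "(\<Prod>i<m. [1, 0, s\<^sup>2] ! (if i = k then 1 else 0)) = 0"
    using assms(2) by (intro prod_zero) (auto intro!: bexI[of _ k])
  moreover have "has_bochner_integral (isotropic_gaussian m s) (\<lambda>f. \<Prod>i<m. f i ^ (if i = k then 1 else 0))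
      (\<Prod>i<m. [1, 0, s\<^sup>2] ! (if i = k then 1 else 0))"
    by (rule gaussian_monomial_moment[OF assms(1)]) simp
  ultimately show ?thesis by (simp only:)
qed

lemma gaussian_covariance:
  assumes "0 < s" "k < m" "l < m"
  shows "has_bochner_integral (isotropic_gaussian m s) (\<lambda>f. f k * f l) (if k = l then s\<^sup>2 else 0)"
proof -
  \<comment> \<open>The exponent of \<open>f i\<close> in \<open>f k * f l\<close>: it is 2 at the
    index \<open>k\<close> if \<open>k = l\<close>; otherwise \<open>k\<close> and \<open>l\<close>
    get 1 each, and a first moment kills the product.\<close>
  let ?p = "\<lambda>i. (if i = k then 1 else 0) + (if i = l then 1 else 0 :: nat)"
  have "(\<Prod>i<m. f i ^ ?p i) = f k * f l" for f :: "nat \<Rightarrow> real"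
    using assms(2,3) unfolding power_add prod.distrib
    by (simp add: if_distrib[where f="\<lambda>x. _ ^ x"] cong: if_cong)
  moreover have "(\<Prod>i<m. [1, 0, s\<^sup>2] ! ?p i) = (if k = l then s\<^sup>2 else 0)"
  proof (cases "k = l")
    case True
    then have "(\<Prod>i<m. [1, 0, s\<^sup>2] ! ?p i) = (\<Prod>i<m. if i = k then s\<^sup>2 else 1)"
      by (intro prod.cong) (auto simp: numeral_2_eq_2)
    then show ?thesis using True assms(2) by simp
  next
    case False
    then show ?thesis using assms(2) by (auto intro!: prod_zero bexI[of _ k])
  qed
  moreover have "has_bochner_integral (isotropic_gaussian m s) (\<lambda>f. \<Prod>i<m. f i ^ ?p i) (\<Prod>i<m. [1, 0, s\<^sup>2] ! ?p i)"
    by (rule gaussian_monomial_moment[OF assms(1)]) simp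
  ultimately show ?thesis by (simp only:)
qed

section \<open>Independence of signal, noise and nodes\<close>

lemma Int_stable_preimage_sets: "Int_stable (preimage_sets M N V)"
proof (rule Int_stableI)
  fix a b assume "a \<in> preimage_sets M N V" "b \<in> preimage_sets M N V"
  then obtain A B where "A \<in> sets N" "B \<in> sets N" "a = V -` A \<inter> space M" "b = V -` B \<inter> space M"
    unfolding preimage_sets_def by auto
  then show "a \<inter> b \<in> preimage_sets M N V"
    unfolding preimage_sets_def by (auto intro!: exI[of _ "A \<inter> B"])
qed

context prob_space
begin

text \<open>Independence of intersection-stable families passes to the sigma-algebras generated by
  disjoint groups of them. The indices 0, 1, 2 stand for \<open>X\<close>, \<open>Y\<close>,
  \<open>Z\<close>; the groupings used are 0 against 1, and 2 against 0 and 1 together.\<close>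

lemma indep_var3_indep_set:
  assumes "indep_var3 M Ma X Mb Y Mc Z" and I: "I \<union> J \<subseteq> {0, 1, 2}" and "I \<inter> J = {}"
  defines "F \<equiv> (!) [preimage_sets M Ma X, preimage_sets M Mb Y, preimage_sets M Mc Z]"
  shows "indep_set (sigma_sets (space M) (\<Union>i\<in>I. F i)) (sigma_sets (space M) (\<Union>i\<in>J. F i))"
proof -
  have indep: "indep_sets F {0, 1, 2}"
    using assms(1) unfolding indep_var3_def F_def by simp
  have stable: "Int_stable (F i)" if "i \<in> {0, 1, 2}" for i
    using that by (auto simp: F_def Int_stable_preimage_sets)
  have "indep_sets (\<lambda>b. sigma_sets (space M) (\<Union>i\<in>case_bool I J b. F i)) (UNIV :: bool set)"
  proof (rule indep_sets_collect_sigma)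
    show "indep_sets F (\<Union>b\<in>UNIV. case_bool I J b)"
      by (rule indep_sets_mono_index[OF _ indep]) (use I in \<open>auto split: bool.splits\<close>)
    show "disjoint_family_on (case_bool I J) UNIV"
      using \<open>I \<inter> J = {}\<close> by (auto simp: disjoint_family_on_def split: bool.splits)
    show "Int_stable (F i)" if "i \<in> case_bool I J b" for i b
      using that I by (intro stable) (auto split: bool.splits)
  qed
  also have "(\<lambda>b. sigma_sets (space M) (\<Union>i\<in>case_bool I J b. F i)) =
      case_bool (sigma_sets (space M) (\<Union>i\<in>I. F i)) (sigma_sets (space M) (\<Union>i\<in>J. F i))"
    by (auto split: bool.splits)
  finally show ?thesis unfolding indep_set_def .
qed

lemma indep_var3_imp_indep_var:
  assumes "indep_var3 M Ma X Mb Y Mc Z"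
  shows "indep_var Ma X Mb Y"
  using assms indep_var3_indep_set[OF assms, of "{0}" "{1}"]
  unfolding indep_var_eq indep_var3_def by (simp add: preimage_sets_def)

text \<open>The pair is measurable for the sigma-algebra generated by the preimages under
  \<open>X\<close> and \<open>Y\<close>, which is independent of that of \<open>Z\<close>. This is
  the product rule required by \<open>nn_integral_independent\<close>.\<close>

lemma indep_var3_prob:
  assumes indep: "indep_var3 M Ma X Mb Y Mc Z" and A: "A \<in> sets Mc" and B: "B \<in> sets (Ma \<Otimes>\<^sub>M Mb)"
  shows "prob ((Z -` A \<inter> space M) \<inter> ((\<lambda>\<omega>. (X \<omega>, Y \<omega>)) -` B \<inter> space M)) =
    prob (Z -` A \<inter> space M) * prob ((\<lambda>\<omega>. (X \<omega>, Y \<omega>)) -` B \<inter> space M)"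
proof -
  have X: "random_variable Ma X" and Y: "random_variable Mb Y"
    using indep unfolding indep_var3_def by auto
  let ?G = "preimage_sets M Ma X \<union> preimage_sets M Mb Y"
  have G: "?G \<subseteq> Pow (space M)" by (auto simp: preimage_sets_def)
  have "X \<in> measurable (sigma (space M) ?G) Ma"
    using measurable_space[OF X] G
    by (intro measurableI) (auto simp: preimage_sets_def intro!: sigma_sets.Basic)
  moreover have "Y \<in> measurable (sigma (space M) ?G) Mb"
    using measurable_space[OF Y] G
    by (intro measurableI) (auto simp: preimage_sets_def intro!: sigma_sets.Basic)
  ultimately have "(\<lambda>\<omega>. (X \<omega>, Y \<omega>)) \<in> measurable (sigma (space M) ?G) (Ma \<Otimes>\<^sub>M Mb)" by simp
  from measurable_sets[OF this B] G
  have "(\<lambda>\<omega>. (X \<omega>, Y \<omega>)) -` B \<inter> space M \<in> sigma_sets (space M) ?G" by simp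
  moreover have "Z -` A \<inter> space M \<in> sigma_sets (space M) (preimage_sets M Mc Z)"
    using A by (auto simp: preimage_sets_def)
  ultimately show ?thesis
    using indep_var3_indep_set[OF indep, of "{2}" "{0, 1}"] by (intro indep_setD) auto
qed

text \<open>The library's \<^const>\<open>indep_var\<close> forces both variables to have values in the same type,
  hence the hypothesis in the form of a product rule.\<close>

lemma nn_integral_independent:
  assumes X: "random_variable S X" and Y: "random_variable T Y"
    and prod: "\<And>A B. A \<in> sets S \<Longrightarrow> B \<in> sets T \<Longrightarrow>
      prob ((X -` A \<inter> space M) \<inter> (Y -` B \<inter> space M)) = prob (X -` A \<inter> space M) * prob (Y -` B \<inter> space M)"
    and f: "f \<in> borel_measurable (S \<Otimes>\<^sub>M T)"
  shows "(\<integral>\<^sup>+ \<omega>. f (X \<omega>, Y \<omega>) \<partial>M) = (\<integral>\<^sup>+ \<omega>. \<integral>\<^sup>+ \<omega>'. f (X \<omega>, Y \<omega>') \<partial>M \<partial>M)"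
proof -
  note [measurable] = X Y
  interpret X: prob_space "distr M S X" by (rule prob_space_distr[OF X])
  interpret Y: prob_space "distr M T Y" by (rule prob_space_distr[OF Y])
  \<comment> \<open>The product rule is agreement on rectangles, which determines the product
    measure; Tonelli's theorem then applies.\<close>
  have eq: "distr M S X \<Otimes>\<^sub>M distr M T Y = distr M (S \<Otimes>\<^sub>M T) (\<lambda>\<omega>. (X \<omega>, Y \<omega>))"
  proof (rule pair_measure_eqI)
    fix A B assume AB: "A \<in> sets (distr M S X)" "B \<in> sets (distr M T Y)"
    have "(\<lambda>\<omega>. (X \<omega>, Y \<omega>)) -` (A \<times> B) \<inter> space M = (X -` A \<inter> space M) \<inter> (Y -` B \<inter> space M)" by auto
    then show "emeasure (distr M S X) A * emeasure (distr M T Y) B =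
        emeasure (distr M (S \<Otimes>\<^sub>M T) (\<lambda>\<omega>. (X \<omega>, Y \<omega>))) (A \<times> B)"
      using AB prod[of A B] by (simp add: emeasure_distr emeasure_eq_measure ennreal_mult[symmetric])
  qed (auto intro: X.sigma_finite_measure_axioms Y.sigma_finite_measure_axioms)
  have "(\<integral>\<^sup>+ \<omega>. f (X \<omega>, Y \<omega>) \<partial>M) = integral\<^sup>N (distr M S X \<Otimes>\<^sub>M distr M T Y) f"
    unfolding eq using f by (subst nn_integral_distr) auto
  also have "\<dots> = (\<integral>\<^sup>+ x. \<integral>\<^sup>+ y. f (x, y) \<partial>distr M T Y \<partial>distr M S X)"
    using f by (intro Y.nn_integral_fst[symmetric]) simp
  also have "\<dots> = (\<integral>\<^sup>+ \<omega>. \<integral>\<^sup>+ y. f (X \<omega>, y) \<partial>distr M T Y \<partial>M)"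
    using f by (intro nn_integral_distr) auto
  also have "\<dots> = (\<integral>\<^sup>+ \<omega>. \<integral>\<^sup>+ \<omega>'. f (X \<omega>, Y \<omega>') \<partial>M \<partial>M)"
    using f measurable_space[OF X] by (intro nn_integral_cong nn_integral_distr) auto
  finally show ?thesis .
qed

text \<open>The modulus is dominated by 1 plus its square, and the total mass is finite. Isotropy of
  \<open>x\<close> supplies second moments only, while the product rule for expectations asks for
  integrability of \<open>x j\<close> itself.\<close>

lemma integrable_of_square_integrable:
  fixes f :: "'a \<Rightarrow> complex"
  assumes f: "f \<in> borel_measurable M" and i: "integrable M (\<lambda>\<omega>. f \<omega> * cnj (f \<omega>))"
  shows "integrable M f"
proof (rule Bochner_Integration.integrable_bound[OF _ f])
  show "integrable M (\<lambda>\<omega>. 1 + cmod (f \<omega> * cnj (f \<omega>)))" using i by simp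
  show "AE \<omega> in M. norm (f \<omega>) \<le> norm (1 + cmod (f \<omega> * cnj (f \<omega>)))"
  proof (rule AE_I2)
    fix \<omega>
    have "0 \<le> (cmod (f \<omega>) - 1)\<^sup>2" by simp
    then have "2 * cmod (f \<omega>) \<le> 1 + cmod (f \<omega>) * cmod (f \<omega>)"
      by (simp add: power2_eq_square algebra_simps)
    moreover have "cmod (f \<omega>) \<le> 2 * cmod (f \<omega>)" by simp
    ultimately have "cmod (f \<omega>) \<le> 1 + cmod (f \<omega>) * cmod (f \<omega>)" by linarith
    then show "norm (f \<omega>) \<le> norm (1 + cmod (f \<omega> * cnj (f \<omega>)))"
      by (simp add: norm_mult)
  qed
qed

text \<open>Split \<open>e k\<close> into real and imaginary parts. The real and imaginary
  contributions to the covariance are equal and add up; the mixed ones vanish because the two parts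
  are independent and centred.\<close>

lemma complex_gaussian_noise_moments:
  assumes noise: "complex_gaussian_noise M m \<epsilon> e" and m: "1 \<le> m" and \<epsilon>: "0 < \<epsilon>"
    and k: "k < m" and l: "l < m"
  shows "has_bochner_integral M (e k) 0"
    and "has_bochner_integral M (\<lambda>\<omega>. e k \<omega> * cnj (e l \<omega>)) (if k = l then of_real (\<epsilon>\<^sup>2 / real m) else 0)"
proof -
  define R where "R = (\<lambda>\<omega>. \<lambda>l\<in>{..<m}. Re (e l \<omega>))"
  define I where "I = (\<lambda>\<omega>. \<lambda>l\<in>{..<m}. Im (e l \<omega>))"
  define P where "P = (\<Pi>\<^sub>M l\<in>{..<m}. (borel :: real measure))"
  \<comment> \<open>The standard deviation of one real component, so that
    \<open>2 * s\<^sup>2 = \<epsilon>\<^sup>2 / real m\<close>.\<close>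
  define s where "s = \<epsilon> / sqrt (2 * real m)"
  have s: "0 < s" using m \<epsilon> by (simp add: s_def)
  have dR: "distr M P R = isotropic_gaussian m s" and dI: "distr M P I = isotropic_gaussian m s"
    and ind: "indep_var P R P I"
    using noise unfolding complex_gaussian_noise_def Let_def R_def I_def P_def s_def by auto
  have R: "random_variable P R" and I: "random_variable P I"
    using ind by (blast dest: indep_var_rv1 indep_var_rv2)+
  have proj: "(\<lambda>f. f i) \<in> borel_measurable P" if "i < m" for i
    unfolding P_def using that by (intro measurable_component_singleton) simp
  have tr: "has_bochner_integral M (\<lambda>\<omega>. g (V \<omega>)) c"
    if "random_variable P V" "distr M P V = isotropic_gaussian m s" "g \<in> borel_measurable P"
      "has_bochner_integral (isotropic_gaussian m s) g c" for g :: "_ \<Rightarrow> real" and c V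
    using that(4) integrable_distr_eq[OF that(1,3)] integral_distr[OF that(1,3)]
    unfolding that(2)[symmetric] has_bochner_integral_iff by simp
  note trR = tr[OF R dR] and trI = tr[OF I dI]
  have mean: "has_bochner_integral M (\<lambda>\<omega>. R \<omega> i) 0" "has_bochner_integral M (\<lambda>\<omega>. I \<omega> i) 0"
    if "i < m" for i
    by (rule trR trI; use that proj gaussian_mean[OF s that] in simp)+
  have cov: "has_bochner_integral M (\<lambda>\<omega>. R \<omega> i * R \<omega> j) (if i = j then s\<^sup>2 else 0)"
    "has_bochner_integral M (\<lambda>\<omega>. I \<omega> i * I \<omega> j) (if i = j then s\<^sup>2 else 0)" if "i < m" "j < m" for i j
  proof -
    have "(\<lambda>f. f i * f j) \<in> borel_measurable P"
      using proj[OF that(1)] proj[OF that(2)] by (rule borel_measurable_times)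
    from trR[OF this gaussian_covariance[OF s that]] trI[OF this gaussian_covariance[OF s that]]
    show "has_bochner_integral M (\<lambda>\<omega>. R \<omega> i * R \<omega> j) (if i = j then s\<^sup>2 else 0)"
      "has_bochner_integral M (\<lambda>\<omega>. I \<omega> i * I \<omega> j) (if i = j then s\<^sup>2 else 0)" .
  qed
  have cross: "has_bochner_integral M (\<lambda>\<omega>. R \<omega> i * I \<omega> j) 0" if "i < m" "j < m" for i j
  proof -
    have "indep_var borel ((\<lambda>f. f i) \<circ> R) borel ((\<lambda>f. f j) \<circ> I)"
      using that proj by (intro indep_var_compose[OF ind]) auto
    then have "indep_var borel (\<lambda>\<omega>. R \<omega> i) borel (\<lambda>\<omega>. I \<omega> j)" by (simp add: o_def)
    from indep_var_lebesgue_integral[OF this] indep_var_integrable[OF this] mean(1)[of i] mean(2)[of j] that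
    show ?thesis by (simp add: has_bochner_integral_iff)
  qed
  have "has_bochner_integral M (\<lambda>\<omega>. complex_of_real (R \<omega> k) + \<i> * complex_of_real (I \<omega> k))
      (of_real 0 + \<i> * of_real 0)"
    using mean[of k] k
    by (intro has_bochner_integral_add has_bochner_integral_mult_right has_bochner_integral_of_real)
  also have "(\<lambda>\<omega>. complex_of_real (R \<omega> k) + \<i> * complex_of_real (I \<omega> k)) = e k"
    using k by (auto simp: R_def I_def complex_eq_iff)
  finally show "has_bochner_integral M (e k) 0" by simp
  have "has_bochner_integral M (\<lambda>\<omega>. complex_of_real (R \<omega> k * R \<omega> l) + complex_of_real (I \<omega> k * I \<omega> l) +
       \<i> * (complex_of_real (R \<omega> l * I \<omega> k) - complex_of_real (R \<omega> k * I \<omega> l)))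
      (of_real (if k = l then s\<^sup>2 else 0) + of_real (if k = l then s\<^sup>2 else 0) + \<i> * (of_real 0 - of_real 0))"
    using k l cov[of k l] cross[OF k l] cross[OF l k]
    by (intro has_bochner_integral_add has_bochner_integral_mult_right has_bochner_integral_of_real
        has_bochner_integral_diff)
  also have "(\<lambda>\<omega>. complex_of_real (R \<omega> k * R \<omega> l) + complex_of_real (I \<omega> k * I \<omega> l) +
       \<i> * (complex_of_real (R \<omega> l * I \<omega> k) - complex_of_real (R \<omega> k * I \<omega> l))) = (\<lambda>\<omega>. e k \<omega> * cnj (e l \<omega>))"
    using k l by (auto simp: R_def I_def complex_eq_iff)
  also have "complex_of_real (if k = l then s\<^sup>2 else 0) + of_real (if k = l then s\<^sup>2 else 0) + \<i> * (of_real 0 - of_real 0) =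
      (if k = l then of_real (\<epsilon>\<^sup>2 / real m) else 0)"
    using m by (simp add: s_def power_divide)
  finally show "has_bochner_integral M (\<lambda>\<omega>. e k \<omega> * cnj (e l \<omega>)) (if k = l then of_real (\<epsilon>\<^sup>2 / real m) else 0)" .
qed

end

section \<open>The mean squared reconstruction error\<close>

lemma frobenius_sq_nonneg: "0 \<le> frobenius_sq A"
  by (simp add: frobenius_sq_def sum_nonneg)

lemma borel_measurable_frobenius_sq:
  assumes "\<And>\<omega>. A \<omega> \<in> carrier_mat m n"
    and "\<And>i j. i < m \<Longrightarrow> j < n \<Longrightarrow> (\<lambda>\<omega>. A \<omega> $$ (i, j)) \<in> borel_measurable M"
  shows "(\<lambda>\<omega>. frobenius_sq (A \<omega>)) \<in> borel_measurable M"
  unfolding frobenius_sq_def carrier_matD[OF assms(1)]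
  using assms(2) by (intro borel_measurable_sum borel_measurable_power borel_measurable_norm) auto

lemma sampling_matrix_carrier: "sampling_matrix m q t \<in> carrier_mat m (2 * q + 1)"
  by (simp add: sampling_matrix_def)

lemma sampling_matrix_index:
  assumes "l < m" "j < 2 * q + 1"
  shows "sampling_matrix m q t $$ (l, j) =
    exp (\<i> * complex_of_real (2 * pi * of_int (int j - int q) * t l))"
  using assms by (simp add: sampling_matrix_def mult_ac)

text \<open>All entries lie on the unit circle. The value does not depend on the nodes and serves as
  the uniform bound for the step size.\<close>

lemma frobenius_sq_sampling_matrix:
  "frobenius_sq (sampling_matrix m q t) = real m * real (2 * q + 1)"
proof -
  have "cmod (sampling_matrix m q t $$ (l, j)) = 1" if "l < m" "j < 2 * q + 1" for l j
    unfolding sampling_matrix_index[OF that] by (rule norm_exp_i_times)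
  then show ?thesis
    using carrier_matD[OF sampling_matrix_carrier[of m q t]] by (simp add: frobenius_sq_def)
qed

text \<open>The inner integral, with the nodes frozen and hence \<open>P\<close> and
  \<open>Q\<close> constant. Signal and noise are stacked into one vector over a disjoint sum of
  index sets, whose covariance is diagonal with entries 1 and \<open>v\<close>.\<close>

lemma nn_integral_affine_norm_sq:
  fixes x e :: "nat \<Rightarrow> 'w \<Rightarrow> complex"
  assumes P: "P \<in> carrier_mat n m" and Q: "Q \<in> carrier_mat n k" and v: "0 \<le> v"
    and x: "\<And>j. j < k \<Longrightarrow> x j \<in> borel_measurable M" and e: "\<And>l. l < m \<Longrightarrow> e l \<in> borel_measurable M"
    and xx: "\<And>i j. i < k \<Longrightarrow> j < k \<Longrightarrow>
      has_bochner_integral M (\<lambda>\<omega>. x i \<omega> * cnj (x j \<omega>)) (if i = j then 1 else 0)"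
    and ee: "\<And>i j. i < m \<Longrightarrow> j < m \<Longrightarrow>
      has_bochner_integral M (\<lambda>\<omega>. e i \<omega> * cnj (e j \<omega>)) (if i = j then of_real v else 0)"
    and xe: "\<And>j l. j < k \<Longrightarrow> l < m \<Longrightarrow> has_bochner_integral M (\<lambda>\<omega>. x j \<omega> * cnj (e l \<omega>)) 0"
  shows "(\<integral>\<^sup>+ \<omega>. ennreal (\<Sum>i<n. (cmod ((\<Sum>j<k. Q $$ (i, j) * x j \<omega>) + (\<Sum>l<m. P $$ (i, l) * e l \<omega>)))\<^sup>2) \<partial>M)
    = ennreal (v * frobenius_sq P + frobenius_sq Q)"
proof -
  let ?I = "{..<k} <+> {..<m}"
  define z where "z = case_sum x e"
  define w where "w i = case_sum (\<lambda>j. Q $$ (i, j)) (\<lambda>l. P $$ (i, l))" for i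
  define c where "c = case_sum (\<lambda>_::nat. 1) (\<lambda>_::nat. v)"
  have ex: "has_bochner_integral M (\<lambda>\<omega>. e l \<omega> * cnj (x j \<omega>)) 0" if "j < k" "l < m" for j l
    using has_bochner_integral_bounded_linear[OF bounded_linear_cnj xe[OF that]]
    by (simp add: mult.commute)
  have zz: "has_bochner_integral M (\<lambda>\<omega>. z a \<omega> * cnj (z b \<omega>)) (if a = b then of_real (c a) else 0)"
    if "a \<in> ?I" "b \<in> ?I" for a b
  proof (cases a; cases b)
    fix i j assume "a = Inl i" "b = Inl j"
    then show ?thesis using that xx[of i j] by (auto simp: z_def c_def)
  next
    fix i j assume "a = Inr i" "b = Inr j"
    then show ?thesis using that ee[of i j] by (auto simp: z_def c_def)
  qed (use that xe ex in \<open>auto simp: z_def\<close>)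
  have z: "z a \<in> borel_measurable M" if "a \<in> ?I" for a
    using that x e by (auto simp: z_def)
  have affine: "(\<Sum>j<k. Q $$ (i, j) * x j \<omega>) + (\<Sum>l<m. P $$ (i, l) * e l \<omega>) = (\<Sum>a\<in>?I. w i a * z a \<omega>)" for i \<omega>
    by (simp add: sum.Plus w_def z_def)
  have "(\<integral>\<^sup>+ \<omega>. ennreal (\<Sum>i<n. (cmod (\<Sum>a\<in>?I. w i a * z a \<omega>))\<^sup>2) \<partial>M) =
      (\<integral>\<^sup>+ \<omega>. (\<Sum>i<n. ennreal ((cmod (\<Sum>a\<in>?I. w i a * z a \<omega>))\<^sup>2)) \<partial>M)"
    by (simp add: sum_ennreal)
  also have "\<dots> = (\<Sum>i<n. \<integral>\<^sup>+ \<omega>. ennreal ((cmod (\<Sum>a\<in>?I. w i a * z a \<omega>))\<^sup>2) \<partial>M)"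
  proof (rule nn_integral_sum)
    fix i
    have "(\<lambda>\<omega>. \<Sum>a\<in>?I. w i a * z a \<omega>) \<in> borel_measurable M"
      using z by (intro borel_measurable_sum borel_measurable_times) auto
    then show "(\<lambda>\<omega>. ennreal ((cmod (\<Sum>a\<in>?I. w i a * z a \<omega>))\<^sup>2)) \<in> borel_measurable M"
      by measurable
  qed
  also have "\<dots> = (\<Sum>i<n. ennreal (\<Sum>a\<in>?I. (cmod (w i a))\<^sup>2 * c a))"
    using zz by (intro sum.cong nn_integral_norm_sq_sum) auto
  also have "\<dots> = ennreal (\<Sum>i<n. \<Sum>a\<in>?I. (cmod (w i a))\<^sup>2 * c a)"
    using v by (intro sum_ennreal sum_nonneg) (auto simp: c_def)
  also have "(\<Sum>i<n. \<Sum>a\<in>?I. (cmod (w i a))\<^sup>2 * c a) = v * frobenius_sq P + frobenius_sq Q"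
    using P Q by (simp add: sum.Plus w_def c_def frobenius_sq_def sum.distrib sum_distrib_left mult_ac add.commute)
  finally show ?thesis unfolding affine .
qed

lemma euclidean_norm_vec_sq: "(euclidean_norm_vec v)\<^sup>2 = (\<Sum>i<dim_vec v. (cmod (v $ i))\<^sup>2)"
  unfolding euclidean_norm_vec_def by (intro real_sqrt_pow2 sum_nonneg) simp

text \<open>In coordinates the error is a function of finitely many scalar random variables, which
  is the form needed for measurability and for the moment computation.\<close>

lemma reconstruction_error_sq:
  assumes A: "A \<in> carrier_mat m n" and P: "P \<in> carrier_mat n m"
  shows "(euclidean_norm_vec (P *\<^sub>v (A *\<^sub>v vec n f + vec m g) - vec n f))\<^sup>2 =
    (\<Sum>i<n. (cmod ((\<Sum>j<n. (P * A - 1\<^sub>m n) $$ (i, j) * f j) + (\<Sum>l<m. P $$ (i, l) * g l)))\<^sup>2)"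
proof -
  let ?x = "vec n f" and ?e = "vec m g"
  have PA: "P * A \<in> carrier_mat n n" using A P by simp
  have "P *\<^sub>v (A *\<^sub>v ?x + ?e) - ?x = (P *\<^sub>v (A *\<^sub>v ?x) + P *\<^sub>v ?e) - 1\<^sub>m n *\<^sub>v ?x"
    using A P by (simp add: mult_add_distrib_mat_vec[of _ n m])
  also have "P *\<^sub>v (A *\<^sub>v ?x) = (P * A) *\<^sub>v ?x"
    using A P by (intro assoc_mult_mat_vec[symmetric]) auto
  also have "(P * A) *\<^sub>v ?x + P *\<^sub>v ?e - 1\<^sub>m n *\<^sub>v ?x = ((P * A) *\<^sub>v ?x - 1\<^sub>m n *\<^sub>v ?x) + P *\<^sub>v ?e"
    using A P by (intro eq_vecI) auto
  also have "(P * A) *\<^sub>v ?x - 1\<^sub>m n *\<^sub>v ?x = (P * A - 1\<^sub>m n) *\<^sub>v ?x"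
    using PA by (intro minus_mult_distrib_mat_vec[symmetric]) auto
  finally have eq: "P *\<^sub>v (A *\<^sub>v ?x + ?e) - ?x = (P * A - 1\<^sub>m n) *\<^sub>v ?x + P *\<^sub>v ?e" .
  have Q: "P * A - 1\<^sub>m n \<in> carrier_mat n n" by (intro minus_carrier_mat) simp
  have idx: "(C *\<^sub>v vec k h) $ i = (\<Sum>j<k. C $$ (i, j) * h j)"
    if "C \<in> carrier_mat n k" "i < n" for C k h and i
    using that by (auto simp: scalar_prod_def atLeast0LessThan intro!: sum.cong)
  have "((P * A - 1\<^sub>m n) *\<^sub>v ?x + P *\<^sub>v ?e) $ i =
      (\<Sum>j<n. (P * A - 1\<^sub>m n) $$ (i, j) * f j) + (\<Sum>l<m. P $$ (i, l) * g l)" if "i < n" for i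
    using that P idx[OF Q that] idx[OF P that] by (simp del: index_mult_mat_vec)
  moreover have "dim_vec ((P * A - 1\<^sub>m n) *\<^sub>v ?x + P *\<^sub>v ?e) = n" using P by simp
  ultimately show ?thesis unfolding eq euclidean_norm_vec_sq by simp
qed

theorem theorem1:
  fixes M :: "'w measure"
    and m q N :: nat
    and \<epsilon> :: real
    and t :: "nat \<Rightarrow> 'w \<Rightarrow> real"
    and x e :: "nat \<Rightarrow> 'w \<Rightarrow> complex"
    and A :: "'w \<Rightarrow> complex mat"
    and X E y xhat :: "'w \<Rightarrow> complex vec"
    and r :: "'w \<Rightarrow> nat"
  assumes "prob_space M"
    and "m \<ge> 1"
    and "N = 2 * q + 1"
    and "\<epsilon> > 0"
    and "uniform_nodes M m t \<or> (\<exists>T>0. jittered_nodes M m T t)"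
    and "isotropic_random_vector M N x"
    and "complex_gaussian_noise M m \<epsilon> e"
    and "indep_var3 M
           (\<Pi>\<^sub>M k\<in>{..<N}. borel) (\<lambda>\<omega>. \<lambda>k\<in>{..<N}. x k \<omega>)
           (\<Pi>\<^sub>M l\<in>{..<m}. borel) (\<lambda>\<omega>. \<lambda>l\<in>{..<m}. e l \<omega>)
           (\<Pi>\<^sub>M l\<in>{..<m}. borel) (\<lambda>\<omega>. \<lambda>l\<in>{..<m}. t l \<omega>)"
    and "A = (\<lambda>\<omega>. sampling_matrix m q (\<lambda>l. t l \<omega>))"
    and "r = (\<lambda>\<omega>. matrix_rank (A \<omega>))"
    and "X = (\<lambda>\<omega>. vec N (\<lambda>k. x k \<omega>))"
    and "E = (\<lambda>\<omega>. vec m (\<lambda>l. e l \<omega>))"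
    and "y = (\<lambda>\<omega>. A \<omega> *\<^sub>v X \<omega> + E \<omega>)"
    and "xhat = (\<lambda>\<omega>. moore_penrose_inverse (A \<omega>) *\<^sub>v y \<omega>)"
  shows "(\<integral>\<^sup>+ \<omega>. ennreal ((euclidean_norm_vec (xhat \<omega> - X \<omega>))\<^sup>2) \<partial>M) =
           ennreal (\<epsilon>\<^sup>2 / real m) *
             (\<integral>\<^sup>+ \<omega>. ennreal (\<Sum>i = 1..r \<omega>. 1 / (singular_value (A \<omega>) i)\<^sup>2) \<partial>M) +
           (\<integral>\<^sup>+ \<omega>. ennreal (real N - real (r \<omega>)) \<partial>M)"
proof -
  interpret prob_space M by fact
  note m = \<open>m \<ge> 1\<close> and N = \<open>N = 2 * q + 1\<close> and \<epsilon> = \<open>\<epsilon> > 0\<close>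
  note noise = \<open>complex_gaussian_noise M m \<epsilon> e\<close> and iso = \<open>isotropic_random_vector M N x\<close>
  define v where "v = \<epsilon>\<^sup>2 / real m"
  have v: "0 \<le> v" by (simp add: v_def)
  define PX where "PX = (\<Pi>\<^sub>M k\<in>{..<N}. (borel :: complex measure))"
  define PE where "PE = (\<Pi>\<^sub>M l\<in>{..<m}. (borel :: complex measure))"
  define PT where "PT = (\<Pi>\<^sub>M l\<in>{..<m}. (borel :: real measure))"
  define XR where "XR = (\<lambda>\<omega>. \<lambda>k\<in>{..<N}. x k \<omega>)"
  define ER where "ER = (\<lambda>\<omega>. \<lambda>l\<in>{..<m}. e l \<omega>)"
  define TR where "TR = (\<lambda>\<omega>. \<lambda>l\<in>{..<m}. t l \<omega>)"
  have indep: "indep_var3 M PX XR PE ER PT TR"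
    using assms(8) unfolding PX_def PE_def PT_def XR_def ER_def TR_def .
  note indXE = indep_var3_imp_indep_var[OF indep]
  have projX: "(\<lambda>f. f j) \<in> borel_measurable PX" if "j < N" for j
    unfolding PX_def using that by (intro measurable_component_singleton) simp
  have projE: "(\<lambda>f. f l) \<in> borel_measurable PE" if "l < m" for l
    unfolding PE_def using that by (intro measurable_component_singleton) simp
  have projT: "(\<lambda>f. f l) \<in> borel_measurable PT" if "l < m" for l
    unfolding PT_def using that by (intro measurable_component_singleton) simp
  have T: "random_variable PT TR" and XE: "random_variable (PX \<Otimes>\<^sub>M PE) (\<lambda>\<omega>. (XR \<omega>, ER \<omega>))"
    using indep unfolding indep_var3_def by auto

  have xmeas: "x j \<in> borel_measurable M" if "j < N" for j
    using iso that by (simp add: isotropic_random_vector_def)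
  have xx: "has_bochner_integral M (\<lambda>\<omega>. x i \<omega> * cnj (x j \<omega>)) (if i = j then 1 else 0)"
    if "i < N" "j < N" for i j
    using iso that by (simp add: isotropic_random_vector_def)
  note emean = complex_gaussian_noise_moments(1)[OF noise m \<epsilon>]
  note ee = complex_gaussian_noise_moments(2)[OF noise m \<epsilon>, folded v_def]
  have emeas: "e l \<in> borel_measurable M" if "l < m" for l
    using emean[OF that that] by (simp add: has_bochner_integral_iff borel_measurable_integrable)
  \<comment> \<open>By independence the expectation factorises, and the factor from the centred
    noise is zero.\<close>
  have xe: "has_bochner_integral M (\<lambda>\<omega>. x j \<omega> * cnj (e l \<omega>)) 0" if "j < N" "l < m" for j l
  proof -
    have "(\<lambda>f. cnj (f l)) \<in> borel_measurable PE"
      using projE[OF that(2)]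
      by (rule measurable_compose) (intro borel_measurable_continuous_onI continuous_intros)
    then have "indep_var borel ((\<lambda>f. f j) \<circ> XR) borel ((\<lambda>f. cnj (f l)) \<circ> ER)"
      using that projX by (intro indep_var_compose[OF indXE]) auto
    then have ind: "indep_var borel (x j) borel (\<lambda>\<omega>. cnj (e l \<omega>))"
      using that by (simp add: o_def XR_def ER_def)
    have "integrable M (x j)"
      using xx[OF that(1,1)]
      by (rule integrable_of_square_integrable[OF xmeas[OF that(1)] integrable.intros])
    moreover have "has_bochner_integral M (\<lambda>\<omega>. cnj (e l \<omega>)) 0"
      using has_bochner_integral_bounded_linear[OF bounded_linear_cnj emean[OF that(2,2)]] by simp
    ultimately show ?thesis
      using indep_var_lebesgue_integral[OF ind] indep_var_integrable[OF ind]
      by (simp add: has_bochner_integral_iff)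
  qed

  \<comment> \<open>\<open>S\<close>, \<open>P\<close> and \<open>Q\<close> are functions of a
    deterministic node vector \<open>\<tau>\<close>; randomness enters only by inserting
    \<open>TR \<omega>\<close>.\<close>
  define S where "S = sampling_matrix m q"
  define P where "P \<tau> = moore_penrose_inverse (S \<tau>)" for \<tau>
  define Q where "Q \<tau> = P \<tau> * S \<tau> - 1\<^sub>m N" for \<tau>
  have S: "S \<tau> \<in> carrier_mat m N" for \<tau> unfolding S_def N by (rule sampling_matrix_carrier)
  have P: "P \<tau> \<in> carrier_mat N m" for \<tau> unfolding P_def by (rule moore_penrose_inverse_carrier[OF S])
  have PS: "P \<tau> * S \<tau> \<in> carrier_mat N N" for \<tau> using mult_carrier_mat[OF P S] .
  have Q: "Q \<tau> \<in> carrier_mat N N" for \<tau> unfolding Q_def by (intro minus_carrier_mat) simp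
  \<comment> \<open>Independence is assumed for the nodes restricted to indices below
    \<open>m\<close>, and the matrix reads no others.\<close>
  have S_TR: "S (\<lambda>l. t l \<omega>) = S (TR \<omega>)" for \<omega>
    by (intro eq_matI) (auto simp: S_def sampling_matrix_def TR_def)
  have Smeas: "(\<lambda>\<tau>. S \<tau> $$ (l, j)) \<in> borel_measurable PT" if "l < m" "j < N" for l j
  proof -
    have "(\<lambda>\<tau>. exp (\<i> * complex_of_real (2 * pi * of_int (int j - int q) * \<tau> l))) \<in> borel_measurable PT"
      using projT[OF that(1)]
      by (rule measurable_compose) (intro borel_measurable_continuous_onI continuous_intros)
    then show ?thesis using that by (simp add: S_def N sampling_matrix_index)
  qed
  have Pmeas: "(\<lambda>\<tau>. P \<tau> $$ (i, l)) \<in> borel_measurable PT" if "i < N" "l < m" for i l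
    unfolding P_def
    by (rule borel_measurable_moore_penrose_inverse[OF S Smeas _ that, where c = "real m * real N"])
       (simp_all add: S_def N frobenius_sq_sampling_matrix)
  have Qmeas: "(\<lambda>\<tau>. Q \<tau> $$ (i, j)) \<in> borel_measurable PT" if "i < N" "j < N" for i j
  proof -
    have "(\<lambda>\<tau>. (P \<tau> * S \<tau>) $$ (i, j) - 1\<^sub>m N $$ (i, j)) \<in> borel_measurable PT"
      by (intro borel_measurable_diff borel_measurable_mat_mult[OF P S Pmeas Smeas that]) auto
    also have "(\<lambda>\<tau>. (P \<tau> * S \<tau>) $$ (i, j) - 1\<^sub>m N $$ (i, j)) = (\<lambda>\<tau>. Q \<tau> $$ (i, j))"
      using that PS unfolding Q_def by (simp del: index_mult_mat(1))
    finally show ?thesis .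
  qed

  \<comment> \<open>The squared error as a function of nodes, signal and noise, arranged so that the
    nodes are separated from the pair of the other two.\<close>
  define F where "F = (\<lambda>(\<tau>, a, b). \<Sum>i<N. (cmod ((\<Sum>j<N. Q \<tau> $$ (i, j) * a j) + (\<Sum>l<m. P \<tau> $$ (i, l) * b l)))\<^sup>2)"
  have F: "F \<in> borel_measurable (PT \<Otimes>\<^sub>M (PX \<Otimes>\<^sub>M PE))"
  proof -
    let ?M = "PT \<Otimes>\<^sub>M (PX \<Otimes>\<^sub>M PE)"
    have "(\<lambda>p. Q (fst p) $$ (i, j)) \<in> borel_measurable ?M" if "i < N" "j < N" for i j
      using Qmeas[OF that] by (rule measurable_compose[OF measurable_fst])
    moreover have "(\<lambda>p. P (fst p) $$ (i, l)) \<in> borel_measurable ?M" if "i < N" "l < m" for i l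
      using Pmeas[OF that] by (rule measurable_compose[OF measurable_fst])
    moreover have "(\<lambda>p. fst (snd p) j) \<in> borel_measurable ?M" if "j < N" for j
      using projX[OF that] by (rule measurable_compose[OF measurable_compose[OF measurable_snd measurable_fst]])
    moreover have "(\<lambda>p. snd (snd p) l) \<in> borel_measurable ?M" if "l < m" for l
      using projE[OF that] by (rule measurable_compose[OF measurable_compose[OF measurable_snd measurable_snd]])
    ultimately show ?thesis
      unfolding F_def case_prod_beta
      by (intro borel_measurable_sum borel_measurable_power borel_measurable_norm
          borel_measurable_add borel_measurable_times) auto
  qed
  have error: "(euclidean_norm_vec (xhat \<omega> - X \<omega>))\<^sup>2 = F (TR \<omega>, XR \<omega>, ER \<omega>)" for \<omega>
  proof -
    have "(euclidean_norm_vec (xhat \<omega> - X \<omega>))\<^sup>2 =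
      (\<Sum>i<N. (cmod ((\<Sum>j<N. Q (TR \<omega>) $$ (i, j) * x j \<omega>) + (\<Sum>l<m. P (TR \<omega>) $$ (i, l) * e l \<omega>)))\<^sup>2)"
      unfolding assms(9,11-14) S_def[symmetric] S_TR P_def[symmetric] Q_def
      by (rule reconstruction_error_sq[OF S P])
    then show ?thesis by (simp add: F_def XR_def ER_def)
  qed
  \<comment> \<open>The outer sample point \<open>\<omega>\<close> carries the nodes; an independent
    copy \<open>\<omega>'\<close> carries signal and noise.\<close>
  have "(\<integral>\<^sup>+ \<omega>. ennreal ((euclidean_norm_vec (xhat \<omega> - X \<omega>))\<^sup>2) \<partial>M) =
      (\<integral>\<^sup>+ \<omega>. \<integral>\<^sup>+ \<omega>'. ennreal (F (TR \<omega>, XR \<omega>', ER \<omega>')) \<partial>M \<partial>M)"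
    unfolding error
    by (rule nn_integral_independent[OF T XE indep_var3_prob[OF indep]
          measurable_compose[OF F measurable_ennreal]])
  also have "\<dots> = (\<integral>\<^sup>+ \<omega>. ennreal (v * frobenius_sq (P (TR \<omega>)) + frobenius_sq (Q (TR \<omega>))) \<partial>M)"
  proof (intro nn_integral_cong)
    fix \<omega>
    have "F (TR \<omega>, XR \<omega>', ER \<omega>') =
      (\<Sum>i<N. (cmod ((\<Sum>j<N. Q (TR \<omega>) $$ (i, j) * x j \<omega>') + (\<Sum>l<m. P (TR \<omega>) $$ (i, l) * e l \<omega>')))\<^sup>2)" for \<omega>'
      by (simp add: F_def XR_def ER_def)
    then show "(\<integral>\<^sup>+ \<omega>'. ennreal (F (TR \<omega>, XR \<omega>', ER \<omega>')) \<partial>M) =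
        ennreal (v * frobenius_sq (P (TR \<omega>)) + frobenius_sq (Q (TR \<omega>)))"
      using nn_integral_affine_norm_sq[OF P Q v xmeas emeas xx ee xe] by simp
  qed
  also have "\<dots> = (\<integral>\<^sup>+ \<omega>. ennreal v * ennreal (frobenius_sq (P (TR \<omega>))) + ennreal (frobenius_sq (Q (TR \<omega>))) \<partial>M)"
    using v by (intro nn_integral_cong) (simp add: ennreal_plus ennreal_mult frobenius_sq_nonneg)
  also have "\<dots> = ennreal v * (\<integral>\<^sup>+ \<omega>. ennreal (frobenius_sq (P (TR \<omega>))) \<partial>M) +
      (\<integral>\<^sup>+ \<omega>. ennreal (frobenius_sq (Q (TR \<omega>))) \<partial>M)"
  proof -
    have "(\<lambda>\<tau>. frobenius_sq (P \<tau>)) \<in> borel_measurable PT"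
      by (rule borel_measurable_frobenius_sq[OF P Pmeas])
    then have "(\<lambda>\<omega>. frobenius_sq (P (TR \<omega>))) \<in> borel_measurable M"
      by (rule measurable_compose[OF T])
    moreover have "(\<lambda>\<tau>. frobenius_sq (Q \<tau>)) \<in> borel_measurable PT"
      by (rule borel_measurable_frobenius_sq[OF Q Qmeas])
    then have "(\<lambda>\<omega>. frobenius_sq (Q (TR \<omega>))) \<in> borel_measurable M"
      by (rule measurable_compose[OF T])
    ultimately show ?thesis by (subst nn_integral_add) (auto simp: nn_integral_cmult)
  qed
  \<comment> \<open>Holds pointwise in the nodes. As \<open>real N - real (r \<omega>)\<close> is a
    squared Frobenius norm, it is nonnegative and \<open>ennreal\<close> truncates nothing.\<close>
  also have "\<dots> = ennreal v *
             (\<integral>\<^sup>+ \<omega>. ennreal (\<Sum>i = 1..r \<omega>. 1 / (singular_value (A \<omega>) i)\<^sup>2) \<partial>M) +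
           (\<integral>\<^sup>+ \<omega>. ennreal (real N - real (r \<omega>)) \<partial>M)"
    unfolding P_def Q_def frobenius_sq_moore_penrose_inverse[OF S] frobenius_sq_moore_penrose_residual[OF S]
      assms(9,10) S_def[symmetric] S_TR ..
  finally show ?thesis unfolding v_def .
qed

end
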